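(* Let $q$ be an odd prime power and let $P$ be a point of the Hermitian surface $H(3,q^2)$. Then $\mathfrak{X}_P=(\mathcal{X},\{R_0,\dots,R_5\})$ is a symmetric, imprimitive association scheme, and its primitive idempotents $E_0,\dots,E_5$ can be ordered so that its first eigenmatrix $\mathcal{P}$ (defined by $A_j=\sum_i\mathcal{P}(i,j)E_i$) has rows $(1,\ (q^2-1)(q+1),\ q-1,\ (q^2-1)^2,\ (q^3-q)(q-1)^2,\ (q^3-q)(q-1))$, $(1,\ q^2-q-1,\ q-1,\ q^3-2q^2+1,\ -q(q-1)^2,\ -q(q-1))$, $(1,\ q^2-1,\ -1,\ -q^2+1,\ 0,\ 0)$, $(1,\ -q-1,\ q-1,\ -q^2+1,\ q(q-1),\ q)$, $(1,\ -q-1,\ -1,\ q+1,\ -q(q+1),\ q(q+1))$, $(1,\ -q-1,\ -1,\ q+1,\ q(q-1),\ -q(q-1))$, and its second eigenmatrix $\mathcal{Q}$ (defined by $E_j=|\mathcal{X}|^{-1}\sum_i\mathcal{Q}(i,j)A_i$) has rows $(1,\ (q-1)(q+1)^2,\ q^3(q-1),\ q(q-1)^2(q+1),\ \tfrac12q^2(q-1)^3,\ \tfrac12q^2(q+1)(q-1)^2)$, $(1,\ q^2-q-1,\ \tfrac{q^3(q-1)}{q+1},\ -q(q-1),\ -\tfrac{q^2(q-1)^2}{2(q+1)},\ -\tfrac12q^2(q-1))$, $(1,\ (q-1)(q+1)^2,\ -q^3,\ q(q-1)^2(q+1),\ -\tfrac12q^2(q-1)^2,\ -\tfrac12q^2(q+1)(q-1))$,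 $(1,\ q^2-q-1,\ -\tfrac{q^3}{q+1},\ -q(q-1),\ \tfrac{q^2(q-1)}{2(q+1)},\ \tfrac{q^2}{2})$, $(1,\ -q-1,\ 0,\ q,\ -\tfrac{q^2}{2},\ \tfrac{q^2}{2})$, $(1,\ -q-1,\ 0,\ q,\ \tfrac12q^2(q-1),\ -\tfrac12q^2(q-1))$. Here $A_j$ is the adjacency matrix of $R_j$.
   Context: $H(3,q^2)$ is the set of points $\langle \mathbf{x}\rangle$ of $\mathrm{PG}(3,q^2)$ with $h(\mathbf{x},\mathbf{x})=0$, where $h(\mathbf{x},\mathbf{y})=x_0y_3^q-x_1y_1^q-x_2y_2^q+x_3y_0^q$. Two points $\langle\mathbf{p}\rangle,\langle\mathbf{q}\rangle$ of $H(3,q^2)$ are collinear if $h(\mathbf{p},\mathbf{q})=0$. For three distinct points $P=\langle\mathbf p\rangle,Q=\langle\mathbf q\rangle,R=\langle\mathbf r\rangle$ of $H(3,q^2)$ let $z(P,Q,R)=h(\mathbf p,\mathbf q)h(\mathbf q,\mathbf r)h(\mathbf r,\mathbf p)\,\mathrm{GF}(q)^*$, which is either $0$ or an element of the group $T=\mathrm{GF}(q^2)^*/\mathrm{GF}(q)^*$ (cyclic of order $q+1$). Let $e=\mathrm{GF}(q)^*$ be the identity of $T$, $t$ its unique involution ($t=\theta\mathrm{GF}(q)^*$ with $\theta^q=-\theta$), and $\Gamma=T\setminus\{e,t\}$. Fix a point $P$ of $H(3,q^2)$ and let $\mathcal{X}$ be the set of the $q^5$ points of $H(3,q^2)$ not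 collinear with $P$. On $\mathcal{X}$ define: $R_0$ the diagonal relation; and for distinct $Q,R\in\mathcal X$: $(Q,R)\in R_1$ iff $z(P,Q,R)=0$; $(Q,R)\in R_2$ iff $P,Q,R$ lie on a common line of $\mathrm{PG}(3,q^2)$; $(Q,R)\in R_3$ iff $z(P,Q,R)=t$; $(Q,R)\in R_4$ iff $z(P,Q,R)\in\Gamma$; $(Q,R)\in R_5$ iff $z(P,Q,R)=e$.
   Formalization: R_3 is taken as "z(P,Q,R)=t and P,Q,R not on a common line": three points P,Q,R on a common line have z(P,Q,R)=t, so with the literal definition R_2 and R_3 overlap and the relations are not a partition. *)

theory Defs
  imports
    "HOL-Analysis.Cartesian_Space"
    "HOL-Algebra.Coset"
    "HOL-Number_Theory.Prime_Powers"
begin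

section \<open>Association schemes\<close>

text \<open>A relation on \<open>X\<close> is a set of pairs, and a scheme with \<open>d\<close> classes is a family
  \<open>R 0, \<dots>, R d\<close>; the values \<open>R i\<close> for \<open>i > d\<close> are irrelevant.\<close>

definition association_scheme :: "'x set \<Rightarrow> nat \<Rightarrow> (nat \<Rightarrow> 'x rel) \<Rightarrow> bool" where
  "association_scheme X d R \<longleftrightarrow>
     finite X \<and> X \<noteq> {} \<and>
     R 0 = Id_on X \<and>
     (\<forall>i\<le>d. R i \<noteq> {}) \<and>
     (\<forall>i\<le>d. \<forall>j\<le>d. i \<noteq> j \<longrightarrow> R i \<inter> R j = {}) \<and>
     (\<Union>i\<le>d. R i) = X \<times> X \<and>
     (\<forall>i\<le>d. \<exists>j\<le>d. (R i)\<inverse> = R j) \<and>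
     (\<exists>p :: nat \<Rightarrow> nat \<Rightarrow> nat \<Rightarrow> nat. \<forall>i\<le>d. \<forall>j\<le>d. \<forall>k\<le>d. \<forall>(x, y) \<in> R k.
        card {z \<in> X. (x, z) \<in> R i \<and> (z, y) \<in> R j} = p i j k)"

text \<open>Symmetry of all relations forces the intersection numbers to satisfy
  \<open>p i j k = p j i k\<close>, so a symmetric scheme is commutative.\<close>

definition symmetric_association_scheme :: "'x set \<Rightarrow> nat \<Rightarrow> (nat \<Rightarrow> 'x rel) \<Rightarrow> bool" where
  "symmetric_association_scheme X d R \<longleftrightarrow>
     association_scheme X d R \<and> (\<forall>i\<le>d. (R i)\<inverse> = R i)"

definition imprimitive_scheme :: "'x set \<Rightarrow> nat \<Rightarrow> (nat \<Rightarrow> 'x rel) \<Rightarrow> bool" where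
  "imprimitive_scheme X d R \<longleftrightarrow>
     (\<exists>I \<subseteq> {..d}. equiv X (\<Union>i\<in>I. R i) \<and>
        (\<Union>i\<in>I. R i) \<noteq> Id_on X \<and> (\<Union>i\<in>I. R i) \<noteq> X \<times> X)"

text \<open>Matrices with rows and columns indexed by \<open>X\<close> are represented by functions
  \<open>'x \<Rightarrow> 'x \<Rightarrow> complex\<close> vanishing outside \<open>X \<times> X\<close>. Adjacency matrices and all elements of the
  Bose-Mesner algebra have this property, so equality of functions is equality of matrices.\<close>

definition adjacency_matrix :: "'x rel \<Rightarrow> 'x \<Rightarrow> 'x \<Rightarrow> complex" where
  "adjacency_matrix S = (\<lambda>x y. if (x, y) \<in> S then 1 else 0)"

definition matrix_product ::
  "'x set \<Rightarrow> ('x \<Rightarrow> 'x \<Rightarrow> complex) \<Rightarrow> ('x \<Rightarrow> 'x \<Rightarrow> complex) \<Rightarrow> 'x \<Rightarrow> 'x \<Rightarrow> complex" where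
  "matrix_product X M N = (\<lambda>x y. \<Sum>z\<in>X. M x z * N z y)"

definition bose_mesner_algebra ::
  "nat \<Rightarrow> (nat \<Rightarrow> 'x rel) \<Rightarrow> ('x \<Rightarrow> 'x \<Rightarrow> complex) set" where
  "bose_mesner_algebra d R =
     {M. \<exists>c :: nat \<Rightarrow> complex. M = (\<lambda>x y. \<Sum>i\<le>d. c i * adjacency_matrix (R i) x y)}"

definition idempotent_in ::
  "'x set \<Rightarrow> ('x \<Rightarrow> 'x \<Rightarrow> complex) set \<Rightarrow> ('x \<Rightarrow> 'x \<Rightarrow> complex) \<Rightarrow> bool" where
  "idempotent_in X \<A> E \<longleftrightarrow> E \<in> \<A> \<and> matrix_product X E E = E"

definition primitive_idempotent ::
  "'x set \<Rightarrow> ('x \<Rightarrow> 'x \<Rightarrow> complex) set \<Rightarrow> ('x \<Rightarrow> 'x \<Rightarrow> complex) \<Rightarrow> bool" where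
  "primitive_idempotent X \<A> E \<longleftrightarrow>
     idempotent_in X \<A> E \<and> E \<noteq> (\<lambda>x y. 0) \<and>
     (\<forall>F G. idempotent_in X \<A> F \<and> idempotent_in X \<A> G \<and>
        matrix_product X F G = (\<lambda>x y. 0) \<and> matrix_product X G F = (\<lambda>x y. 0) \<and>
        E = (\<lambda>x y. F x y + G x y) \<longrightarrow> F = (\<lambda>x y. 0) \<or> G = (\<lambda>x y. 0))"

definition primitive_idempotents ::
  "'x set \<Rightarrow> nat \<Rightarrow> (nat \<Rightarrow> 'x rel) \<Rightarrow> ('x \<Rightarrow> 'x \<Rightarrow> complex) set" where
  "primitive_idempotents X d R = {E. primitive_idempotent X (bose_mesner_algebra d R) E}"

text \<open>Eigenmatrices are given as lists of rows, with rows and columns numbered from \<open>0\<close>.\<close>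

definition is_first_eigenmatrix ::
  "nat \<Rightarrow> (nat \<Rightarrow> 'x rel) \<Rightarrow> (nat \<Rightarrow> 'x \<Rightarrow> 'x \<Rightarrow> complex) \<Rightarrow> real list list \<Rightarrow> bool" where
  "is_first_eigenmatrix d R E PP \<longleftrightarrow>
     (\<forall>j\<le>d. adjacency_matrix (R j) = (\<lambda>x y. \<Sum>i\<le>d. of_real (PP ! i ! j) * E i x y))"

definition is_second_eigenmatrix ::
  "'x set \<Rightarrow> nat \<Rightarrow> (nat \<Rightarrow> 'x rel) \<Rightarrow> (nat \<Rightarrow> 'x \<Rightarrow> 'x \<Rightarrow> complex) \<Rightarrow> real list list \<Rightarrow> bool" where
  "is_second_eigenmatrix X d R E QQ \<longleftrightarrow>
     (\<forall>j\<le>d. E j = (\<lambda>x y. inverse (of_nat (card X)) *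
        (\<Sum>i\<le>d. of_real (QQ ! i ! j) * adjacency_matrix (R i) x y)))"


section \<open>The Hermitian surface\<close>

text \<open>Throughout, \<open>'a\<close> is a field with \<open>q\<^sup>2\<close> elements. The index type \<open>4\<close> has the elements
  \<open>0, 1, 2, 3\<close>. Points and lines of \<open>PG(3,q\<^sup>2)\<close> are the subspaces of \<open>'a^4\<close> of
  dimension 1 and 2.\<close>

definition hform :: "nat \<Rightarrow> 'a::field ^ 4 \<Rightarrow> 'a ^ 4 \<Rightarrow> 'a" where
  "hform q x y =
     x $ 0 * (y $ 3) ^ q - x $ 1 * (y $ 1) ^ q - x $ 2 * (y $ 2) ^ q + x $ 3 * (y $ 0) ^ q"

definition hermitian_surface :: "nat \<Rightarrow> ('a::field ^ 4) set set" where
  "hermitian_surface q = {vec.span {x} | x. x \<noteq> 0 \<and> hform q x x = 0}"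

definition rep :: "('a::field ^ 4) set \<Rightarrow> 'a ^ 4" where
  "rep P = (SOME x. x \<noteq> 0 \<and> P = vec.span {x})"

definition collinear_on_surface ::
  "nat \<Rightarrow> ('a::field ^ 4) set \<Rightarrow> ('a ^ 4) set \<Rightarrow> bool" where
  "collinear_on_surface q P Q \<longleftrightarrow> hform q (rep P) (rep Q) = 0"

definition on_common_line ::
  "('a::field ^ 4) set \<Rightarrow> ('a ^ 4) set \<Rightarrow> ('a ^ 4) set \<Rightarrow> bool" where
  "on_common_line P Q R \<longleftrightarrow>
     (\<exists>L. vec.subspace L \<and> vec.dim L = 2 \<and> P \<subseteq> L \<and> Q \<subseteq> L \<and> R \<subseteq> L)"

definition mult_group :: "'a::field monoid" where
  "mult_group = \<lparr>carrier = UNIV - {0}, monoid.mult = (*), one = 1\<rparr>"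

text \<open>The subfield of order \<open>q\<close> is the fixed field of \<open>x \<mapsto> x\<^sup>q\<close>.\<close>

definition GFq_star :: "nat \<Rightarrow> 'a::field set" where
  "GFq_star q = {x. x ^ q = x} - {0}"

definition T_group :: "nat \<Rightarrow> 'a::field set monoid" where
  "T_group q = mult_group Mod (GFq_star q)"

definition T_involution :: "nat \<Rightarrow> 'a::field set" where
  "T_involution q = (THE \<tau>. \<tau> \<in> carrier (T_group q) \<and> \<tau> \<noteq> \<one>\<^bsub>T_group q\<^esub> \<and>
     \<tau> \<otimes>\<^bsub>T_group q\<^esub> \<tau> = \<one>\<^bsub>T_group q\<^esub>)"

definition T_Gamma :: "nat \<Rightarrow> 'a::field set set" where
  "T_Gamma q = carrier (T_group q) - {\<one>\<^bsub>T_group q\<^esub>, T_involution q}"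

text \<open>The coset \<open>z(P,Q,R)\<close>; it equals \<open>{0}\<close> when the product of the form values is \<open>0\<close>.\<close>

definition z_triple ::
  "nat \<Rightarrow> ('a::field ^ 4) set \<Rightarrow> ('a ^ 4) set \<Rightarrow> ('a ^ 4) set \<Rightarrow> 'a set" where
  "z_triple q P Q R = GFq_star q #>\<^bsub>mult_group\<^esub>
     (hform q (rep P) (rep Q) * hform q (rep Q) (rep R) * hform q (rep R) (rep P))"

definition noncollinear_points ::
  "nat \<Rightarrow> ('a::field ^ 4) set \<Rightarrow> ('a ^ 4) set set" where
  "noncollinear_points q P = {Q \<in> hermitian_surface q. \<not> collinear_on_surface q P Q}"

text \<open>If \<open>P\<close>, \<open>Q\<close>, \<open>R\<close> lie on a common line (necessarily a hyperbolic one), then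
  \<open>z(P,Q,R)\<close> is the involution. Hence relation 3 has to exclude the pairs of relation 2 for
  the relations to be disjoint.\<close>

definition scheme_rel ::
  "nat \<Rightarrow> ('a::field ^ 4) set \<Rightarrow> nat \<Rightarrow> ('a ^ 4) set rel" where
  "scheme_rel q P i = {(Q, R) \<in> noncollinear_points q P \<times> noncollinear_points q P.
     [Q = R,
      Q \<noteq> R \<and> z_triple q P Q R = {0},
      Q \<noteq> R \<and> on_common_line P Q R,
      Q \<noteq> R \<and> z_triple q P Q R = T_involution q \<and> \<not> on_common_line P Q R,
      Q \<noteq> R \<and> z_triple q P Q R \<in> T_Gamma q,
      Q \<noteq> R \<and> z_triple q P Q R = \<one>\<^bsub>T_group q\<^esub>] ! i}"


section \<open>The eigenmatrices\<close>

definition eigenmatrix_P :: "real \<Rightarrow> real list list" where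
  "eigenmatrix_P q =
    [[1, (q^2 - 1) * (q + 1), q - 1, (q^2 - 1)^2, (q^3 - q) * (q - 1)^2, (q^3 - q) * (q - 1)],
     [1, q^2 - q - 1, q - 1, q^3 - 2 * q^2 + 1, - q * (q - 1)^2, - q * (q - 1)],
     [1, q^2 - 1, - 1, - (q^2) + 1, 0, 0],
     [1, - q - 1, q - 1, - (q^2) + 1, q * (q - 1), q],
     [1, - q - 1, - 1, q + 1, - q * (q + 1), q * (q + 1)],
     [1, - q - 1, - 1, q + 1, q * (q - 1), - q * (q - 1)]]"

definition eigenmatrix_Q :: "real \<Rightarrow> real list list" where
  "eigenmatrix_Q q =
    [[1, (q - 1) * (q + 1)^2, q^3 * (q - 1), q * (q - 1)^2 * (q + 1),
        1/2 * q^2 * (q - 1)^3, 1/2 * q^2 * (q + 1) * (q - 1)^2],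
     [1, q^2 - q - 1, q^3 * (q - 1) / (q + 1), - q * (q - 1),
        - (q^2 * (q - 1)^2 / (2 * (q + 1))), - (1/2 * q^2 * (q - 1))],
     [1, (q - 1) * (q + 1)^2, - (q^3), q * (q - 1)^2 * (q + 1),
        - (1/2 * q^2 * (q - 1)^2), - (1/2 * q^2 * (q + 1) * (q - 1))],
     [1, q^2 - q - 1, - (q^3 / (q + 1)), - q * (q - 1),
        q^2 * (q - 1) / (2 * (q + 1)), q^2 / 2],
     [1, - q - 1, 0, q, - (q^2 / 2), q^2 / 2],
     [1, - q - 1, 0, q, 1/2 * q^2 * (q - 1), - (1/2 * q^2 * (q - 1))]]"


section \<open>Independence of representatives\<close>

lemma span_single_eq_imp_scale:
  fixes x y :: "'a::field ^ 4"
  assumes "x \<noteq> 0" "vec.span {x} = vec.span {y}"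
  obtains c where "c \<noteq> 0" "x = c *s y"
proof -
  have "x \<in> vec.span {y}"
    using assms(2) vec.span_base[of x "{x}"] by auto
  then obtain c where c: "x = c *s y"
    by (auto simp: vec.span_singleton)
  with assms(1) have "c \<noteq> 0" by auto
  with c show ?thesis using that by blast
qed

lemma rep_span:
  fixes x :: "'a::field ^ 4"
  assumes "x \<noteq> 0"
  obtains c where "c \<noteq> 0" "rep (vec.span {x}) = c *s x"
proof -
  have "rep (vec.span {x}) \<noteq> 0 \<and> vec.span {x} = vec.span {rep (vec.span {x})}"
    unfolding rep_def by (rule someI[of _ x]) (use assms in simp)
  then show ?thesis
    using span_single_eq_imp_scale[of "rep (vec.span {x})" x] that by metis
qed

lemma hform_scale:
  "hform q (c *s x) (d *s y) = c * d ^ q * hform q x y"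
  by (simp add: hform_def power_mult_distrib algebra_simps)

lemma collinear_on_surface_span:
  fixes x y :: "'a::field ^ 4"
  assumes "x \<noteq> 0" "y \<noteq> 0"
  shows "collinear_on_surface q (vec.span {x}) (vec.span {y}) \<longleftrightarrow> hform q x y = 0"
proof -
  obtain c d where "c \<noteq> 0" "rep (vec.span {x}) = c *s x" "d \<noteq> 0" "rep (vec.span {y}) = d *s y"
    using rep_span[OF assms(1)] rep_span[OF assms(2)] by metis
  then show ?thesis by (simp add: collinear_on_surface_def hform_scale)
qed

lemma power_card_field:
  fixes a :: "'a::{field,finite}"
  shows "a ^ CARD('a) = a"
proof (cases "a = 0")
  case False
  let ?S = "UNIV - {0::'a}"
  have "bij_betw ((*) a) ?S ?S"
    by (rule bij_betwI[where g = "\<lambda>x. x / a"]) (use False in auto)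
  then have "(\<Prod>x\<in>?S. a * x) = \<Prod>?S"
    using prod.reindex_bij_betw[of "(*) a" ?S ?S "\<lambda>x. x"] by simp
  then have "a ^ card ?S * \<Prod>?S = \<Prod>?S"
    by (simp add: prod.distrib)
  moreover have "\<Prod>?S \<noteq> 0" by simp
  ultimately have pow: "a ^ card ?S = 1" by simp
  have card: "CARD('a) = Suc (card ?S)" by (rule card.remove) auto
  show ?thesis unfolding card power_Suc pow by simp
qed (simp add: zero_power)

lemma z_triple_span:
  fixes x y w :: "'a::{field,finite} ^ 4"
  assumes q: "CARD('a) = q ^ 2" and nz: "x \<noteq> 0" "y \<noteq> 0" "w \<noteq> 0"
  shows "z_triple q (vec.span {x}) (vec.span {y}) (vec.span {w}) =
    {k * (hform q x y * hform q y w * hform q w x) | k. k \<in> GFq_star q}"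
proof -
  obtain a where a: "a \<noteq> 0" "rep (vec.span {x}) = a *s x" using rep_span[OF nz(1)] .
  obtain b where b: "b \<noteq> 0" "rep (vec.span {y}) = b *s y" using rep_span[OF nz(2)] .
  obtain c where c: "c \<noteq> 0" "rep (vec.span {w}) = c *s w" using rep_span[OF nz(3)] .
  define u where "u = a ^ Suc q * b ^ Suc q * c ^ Suc q"
  have qq: "s ^ (q * q) = s" for s :: 'a
    using power_card_field[of s] q by (simp add: power2_eq_square)
  have u: "u \<noteq> 0" "u ^ q = u"
    using a(1) b(1) c(1)
    by (simp_all add: u_def power_mult_distrib power_add qq mult.commute flip: power_mult)
  have mult_in: "k * u \<in> GFq_star q" and div_in: "k / u \<in> GFq_star q"
    if "k \<in> GFq_star q" for k
    using that u by (auto simp: GFq_star_def power_mult_distrib power_divide)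
  let ?h = "hform q x y * hform q y w * hform q w x"
  have "z_triple q (vec.span {x}) (vec.span {y}) (vec.span {w}) =
      {k * (u * ?h) | k. k \<in> GFq_star q}"
    by (auto simp: z_triple_def r_coset_def mult_group_def a(2) b(2) c(2) hform_scale u_def
        mult_ac)
  also have "\<dots> = {k * ?h | k. k \<in> GFq_star q}"
  proof (intro equalityI subsetI; clarify)
    fix k :: 'a assume "k \<in> GFq_star q"
    then show "\<exists>k'. k * (u * ?h) = k' * ?h \<and> k' \<in> GFq_star q"
      using mult_in by (intro exI[of _ "k * u"]) (auto simp: mult_ac)
  next
    fix k :: 'a assume "k \<in> GFq_star q"
    then show "\<exists>k'. k * ?h = k' * (u * ?h) \<and> k' \<in> GFq_star q"
      using div_in u(1) by (intro exI[of _ "k / u"]) auto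
  qed
  finally show ?thesis .
qed

end

theory Submission
  imports Defs "HOL-Computational_Algebra.Polynomial" "HOL-Number_Theory.Residues"
begin

text \<open>In coordinates with \<open>P = \<langle>(1,0,0,0)\<rangle>\<close> the points not collinear with \<open>P\<close> are
  \<open>\<langle>(N(v)/2 + s, v, 1)\<rangle>\<close> with \<open>v \<in> K\<^sup>2\<close> and \<open>s\<^sup>q = -s\<close>, where \<open>N\<close> is the norm form of the standard
  Hermitian inner product on \<open>K\<^sup>2\<close>. For two such points the coset \<open>z(P,Q,R)\<close> is represented by
  \<open>h(Q,R) = N(v' - v)/2 + \<beta>\<close>, where \<open>\<beta>\<close> is a skew element, so the relations only record whether
  \<open>v' - v\<close> is zero, isotropic or anisotropic and whether \<open>\<beta> = 0\<close>. Fixing one point turns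
  intersection numbers into counts of vectors \<open>a \<in> K\<^sup>2\<close> with prescribed isotropy of \<open>a\<close> and
  \<open>b - a\<close> and prescribed skew part of \<open>\<langle>a,b\<rangle>\<close>; these follow from the equidistribution of trace
  and norm.

  Write \<open>PP\<close> and \<open>QQ\<close> for the eigenmatrices and \<open>n = |X|\<close>. The rows of \<open>PP\<close> are characters of the
  Bose-Mesner algebra if and only if \<open>n p\<^sub>i\<^sub>j\<^sup>k = \<Sum>\<^sub>m PP(m,i) PP(m,j) QQ(k,m)\<close>. Together with
  \<open>PP QQ = QQ PP = n I\<close> this identity yields the scheme axioms and the idempotents.\<close>

section \<open>Schemes determined by a pair of eigenmatrices\<close>

locale eigenmatrix_scheme =
  fixes X :: "'x set" and d :: nat and R :: "nat \<Rightarrow> 'x rel" and cl :: "'x \<Rightarrow> 'x \<Rightarrow> nat"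
    and PP QQ :: "real list list"
  assumes fin: "finite X" and ne: "X \<noteq> {}"
    and R: "i \<le> d \<Longrightarrow> R i = {(x, y) \<in> X \<times> X. cl x y = i}"
    and cl_le: "x \<in> X \<Longrightarrow> y \<in> X \<Longrightarrow> cl x y \<le> d"
    and cl_eq_0: "x \<in> X \<Longrightarrow> y \<in> X \<Longrightarrow> cl x y = 0 \<longleftrightarrow> x = y"
    and cl_commute: "x \<in> X \<Longrightarrow> y \<in> X \<Longrightarrow> cl x y = cl y x"
    and cl_ex: "i \<le> d \<Longrightarrow> \<exists>x\<in>X. \<exists>y\<in>X. cl x y = i"
    and PQ: "i \<le> d \<Longrightarrow> j \<le> d \<Longrightarrow>
      (\<Sum>k\<le>d. PP ! i ! k * QQ ! k ! j) = (if i = j then real (card X) else 0)"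
    and QP: "i \<le> d \<Longrightarrow> j \<le> d \<Longrightarrow>
      (\<Sum>k\<le>d. QQ ! i ! k * PP ! k ! j) = (if i = j then real (card X) else 0)"
    and count: "x \<in> X \<Longrightarrow> y \<in> X \<Longrightarrow> i \<le> d \<Longrightarrow> j \<le> d \<Longrightarrow>
      real (card X) * real (card {z \<in> X. cl x z = i \<and> cl z y = j}) =
        (\<Sum>m\<le>d. PP ! m ! i * PP ! m ! j * QQ ! cl x y ! m)"
begin

section \<open>The Bose-Mesner algebra in coordinates over the idempotents\<close>

definition idem :: "nat \<Rightarrow> 'x \<Rightarrow> 'x \<Rightarrow> complex" where
  "idem m = (\<lambda>x y. inverse (of_nat (card X)) *
     (\<Sum>i\<le>d. of_real (QQ ! i ! m) * adjacency_matrix (R i) x y))"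

text \<open>The matrix with eigenvalue \<open>c m\<close> on the \<open>m\<close>-th eigenspace. In
  these coordinates multiplication becomes pointwise (\<open>lin_product\<close>), so questions
  about idempotents reduce to functions on \<open>{..d}\<close>.\<close>

definition lin :: "(nat \<Rightarrow> complex) \<Rightarrow> 'x \<Rightarrow> 'x \<Rightarrow> complex" where
  "lin c = (\<lambda>x y. \<Sum>m\<le>d. c m * idem m x y)"

lemma card_pos: "card X > 0"
  using fin ne by (simp add: card_gt_0_iff)

lemma adjacency:
  "j \<le> d \<Longrightarrow> adjacency_matrix (R j) x y = (if x \<in> X \<and> y \<in> X \<and> cl x y = j then 1 else 0)"
  by (simp add: adjacency_matrix_def R)

lemma idem_eq:
  "idem m x y = (if x \<in> X \<and> y \<in> X then of_real (QQ ! cl x y ! m) / of_nat (card X) else 0)"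
proof -
  have "(\<Sum>i\<le>d. of_real (QQ ! i ! m) * adjacency_matrix (R i) x y) =
      (\<Sum>i\<le>d. if cl x y = i then (if x \<in> X \<and> y \<in> X then complex_of_real (QQ ! cl x y ! m) else 0) else 0)"
    by (intro sum.cong) (auto simp: adjacency)
  also have "\<dots> = (if x \<in> X \<and> y \<in> X then of_real (QQ ! cl x y ! m) else 0)"
    using cl_le[of x y] by (auto simp: sum.delta')
  finally show ?thesis by (simp add: idem_def divide_simps)
qed

lemma lin_out: "\<not> (x \<in> X \<and> y \<in> X) \<Longrightarrow> lin c x y = 0"
  by (auto simp: lin_def idem_eq)

lemma adjacency_lin:
  assumes "j \<le> d"
  shows "adjacency_matrix (R j) = lin (\<lambda>m. of_real (PP ! m ! j))"
proof (intro ext)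
  fix x y
  show "adjacency_matrix (R j) x y = lin (\<lambda>m. of_real (PP ! m ! j)) x y"
  proof (cases "x \<in> X \<and> y \<in> X")
    case True
    have "lin (\<lambda>m. of_real (PP ! m ! j)) x y =
        of_real (\<Sum>m\<le>d. QQ ! cl x y ! m * PP ! m ! j) / of_nat (card X)"
      using True by (simp add: lin_def idem_eq sum_divide_distrib mult.commute)
    also have "\<dots> = (if cl x y = j then 1 else 0)"
      using True assms QP[of "cl x y" j] cl_le[of x y] card_pos by simp
    finally show ?thesis using True assms by (simp add: adjacency)
  qed (use assms in \<open>auto simp: adjacency lin_out\<close>)
qed

text \<open>An entry of the product counts the intermediate points, so this is the assumption
  \<open>count\<close> read entrywise: each row of \<open>PP\<close> is multiplicative.\<close>

lemma adjacency_product: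
  assumes "i \<le> d" "j \<le> d"
  shows "matrix_product X (adjacency_matrix (R i)) (adjacency_matrix (R j)) =
    lin (\<lambda>m. of_real (PP ! m ! i * PP ! m ! j))"
proof (intro ext)
  fix x y
  show "matrix_product X (adjacency_matrix (R i)) (adjacency_matrix (R j)) x y =
    lin (\<lambda>m. of_real (PP ! m ! i * PP ! m ! j)) x y"
  proof (cases "x \<in> X \<and> y \<in> X")
    case True
    have "matrix_product X (adjacency_matrix (R i)) (adjacency_matrix (R j)) x y =
        (\<Sum>z\<in>X. if cl x z = i \<and> cl z y = j then 1 else 0)"
      unfolding matrix_product_def
      by (intro sum.cong) (use True assms in \<open>auto simp: adjacency\<close>)
    also have "\<dots> = of_nat (card {z \<in> X. cl x z = i \<and> cl z y = j})"
      using fin by (simp add: sum.If_cases Int_def)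
    also have "\<dots> = of_real (\<Sum>m\<le>d. PP ! m ! i * PP ! m ! j * QQ ! cl x y ! m) / of_nat (card X)"
      using card_pos True assms by (subst count[symmetric]) auto
    also have "\<dots> = lin (\<lambda>m. of_real (PP ! m ! i * PP ! m ! j)) x y"
      using True by (simp add: lin_def idem_eq sum_divide_distrib)
    finally show ?thesis .
  next
    case False
    then show ?thesis
      using assms by (auto simp: lin_out matrix_product_def adjacency)
  qed
qed

lemma combination_eq_lin:
  "(\<lambda>x y. \<Sum>i\<le>d. c i * adjacency_matrix (R i) x y) = lin (\<lambda>m. \<Sum>i\<le>d. of_real (PP ! m ! i) * c i)"
proof (intro ext)
  fix x y
  have "(\<Sum>i\<le>d. c i * adjacency_matrix (R i) x y) =
      (\<Sum>i\<le>d. \<Sum>m\<le>d. of_real (PP ! m ! i) * c i * idem m x y)"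
    by (simp add: adjacency_lin lin_def sum_distrib_left mult_ac)
  then show "(\<Sum>i\<le>d. c i * adjacency_matrix (R i) x y) =
      lin (\<lambda>m. \<Sum>i\<le>d. of_real (PP ! m ! i) * c i) x y"
    by (subst (asm) sum.swap) (simp add: lin_def sum_distrib_right)
qed

lemma combination_product:
  "matrix_product X (\<lambda>x y. \<Sum>i\<le>d. b i * adjacency_matrix (R i) x y)
      (\<lambda>x y. \<Sum>i\<le>d. c i * adjacency_matrix (R i) x y) =
    lin (\<lambda>m. (\<Sum>i\<le>d. of_real (PP ! m ! i) * b i) * (\<Sum>i\<le>d. of_real (PP ! m ! i) * c i))"
proof (intro ext)
  fix x y
  let ?A = "\<lambda>i. adjacency_matrix (R i)"
  have "matrix_product X (\<lambda>x y. \<Sum>i\<le>d. b i * ?A i x y) (\<lambda>x y. \<Sum>i\<le>d. c i * ?A i x y) x y =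
      (\<Sum>z\<in>X. \<Sum>i\<le>d. \<Sum>j\<le>d. b i * c j * (?A i x z * ?A j z y))"
    by (simp add: matrix_product_def sum_product mult_ac)
  also have "\<dots> = (\<Sum>i\<le>d. \<Sum>j\<le>d. \<Sum>z\<in>X. b i * c j * (?A i x z * ?A j z y))"
    by (subst sum.swap, intro sum.cong refl, rule sum.swap)
  also have "\<dots> = (\<Sum>i\<le>d. \<Sum>j\<le>d. b i * c j * matrix_product X (?A i) (?A j) x y)"
    by (simp add: matrix_product_def sum_distrib_left)
  also have "\<dots> = (\<Sum>i\<le>d. \<Sum>j\<le>d. \<Sum>m\<le>d. of_real (PP ! m ! i) * b i * (of_real (PP ! m ! j) * c j) * idem m x y)"
    by (intro sum.cong refl) (simp add: adjacency_product lin_def sum_distrib_left mult_ac)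
  also have "\<dots> = (\<Sum>m\<le>d. \<Sum>i\<le>d. \<Sum>j\<le>d. of_real (PP ! m ! i) * b i * (of_real (PP ! m ! j) * c j) * idem m x y)"
    by (subst (2) sum.swap, subst sum.swap) (rule refl)
  also have "\<dots> = lin (\<lambda>m. (\<Sum>i\<le>d. of_real (PP ! m ! i) * b i) * (\<Sum>i\<le>d. of_real (PP ! m ! i) * c i)) x y"
    unfolding lin_def
    by (intro sum.cong refl, subst sum.swap) (simp add: sum_distrib_right sum_distrib_left mult_ac)
  finally show "matrix_product X (\<lambda>x y. \<Sum>i\<le>d. b i * ?A i x y) (\<lambda>x y. \<Sum>i\<le>d. c i * ?A i x y) x y =
    lin (\<lambda>m. (\<Sum>i\<le>d. of_real (PP ! m ! i) * b i) * (\<Sum>i\<le>d. of_real (PP ! m ! i) * c i)) x y" .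
qed

lemma lin_cong: "(\<And>m. m \<le> d \<Longrightarrow> b m = c m) \<Longrightarrow> lin b = lin c"
  by (simp add: lin_def)

text \<open>Since \<open>PP QQ = n I\<close>, applying \<open>QQ / n\<close> to the eigenvalues
  \<open>c\<close> recovers coefficients with respect to the adjacency matrices.\<close>

lemma lin_as_combination:
  fixes c :: "nat \<Rightarrow> complex"
  obtains b where "lin c = (\<lambda>x y. \<Sum>i\<le>d. b i * adjacency_matrix (R i) x y)"
    and "\<And>m. m \<le> d \<Longrightarrow> (\<Sum>i\<le>d. of_real (PP ! m ! i) * b i) = c m"
proof -
  define b where "b i = (\<Sum>k\<le>d. of_real (QQ ! i ! k) * c k) / of_nat (card X)" for i
  have b: "(\<Sum>i\<le>d. of_real (PP ! m ! i) * b i) = c m" if "m \<le> d" for m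
  proof -
    have "(\<Sum>i\<le>d. of_real (PP ! m ! i) * b i) =
        (\<Sum>i\<le>d. \<Sum>k\<le>d. of_real (PP ! m ! i * QQ ! i ! k) * c k) / of_nat (card X)"
      by (simp add: b_def sum_distrib_left sum_divide_distrib mult_ac)
    also have "\<dots> = (\<Sum>k\<le>d. of_real (\<Sum>i\<le>d. PP ! m ! i * QQ ! i ! k) * c k) / of_nat (card X)"
      by (subst sum.swap) (simp add: sum_distrib_right)
    also have "\<dots> = (\<Sum>k\<le>d. if m = k then of_nat (card X) * c k else 0) / of_nat (card X)"
      using that by (intro arg_cong2[where f = "(/)"] sum.cong refl) (subst PQ, auto)
    also have "\<dots> = c m" using that card_pos by simp
    finally show ?thesis .
  qed
  show ?thesis
    by (rule that[OF _ b]) (auto simp: combination_eq_lin intro: lin_cong b[symmetric])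
qed

lemma bose_mesner_eq: "bose_mesner_algebra d R = range lin"
proof (intro equalityI subsetI)
  fix M assume "M \<in> bose_mesner_algebra d R"
  then show "M \<in> range lin" by (auto simp: bose_mesner_algebra_def combination_eq_lin)
next
  fix M assume "M \<in> range lin"
  then obtain c where M: "M = lin c" by auto
  show "M \<in> bose_mesner_algebra d R"
    using lin_as_combination[of c] unfolding M bose_mesner_algebra_def by blast
qed

lemma lin_product: "matrix_product X (lin b) (lin c) = lin (\<lambda>m. b m * c m)"
proof -
  obtain b' where b': "lin b = (\<lambda>x y. \<Sum>i\<le>d. b' i * adjacency_matrix (R i) x y)"
    "\<And>m. m \<le> d \<Longrightarrow> (\<Sum>i\<le>d. of_real (PP ! m ! i) * b' i) = b m" by (rule lin_as_combination[of b]) blast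
  obtain c' where c': "lin c = (\<lambda>x y. \<Sum>i\<le>d. c' i * adjacency_matrix (R i) x y)"
    "\<And>m. m \<le> d \<Longrightarrow> (\<Sum>i\<le>d. of_real (PP ! m ! i) * c' i) = c m" by (rule lin_as_combination[of c]) blast
  show ?thesis
    unfolding b'(1) c'(1) combination_product by (rule lin_cong) (simp add: b'(2) c'(2))
qed

lemma lin_delta: "a \<le> d \<Longrightarrow> lin (\<lambda>m. if m = a then c else 0) = (\<lambda>x y. c * idem a x y)"
  by (simp add: lin_def if_distrib[of "\<lambda>u. u * _"] cong: if_cong)

lemma idem_lin: "a \<le> d \<Longrightarrow> idem a = lin (\<lambda>m. if m = a then 1 else 0)"
  by (simp add: lin_delta)

text \<open>Every class occurs, so a vanishing \<open>idem a\<close> would make column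
  \<open>a\<close> of \<open>QQ\<close> zero, against the diagonal entry \<open>n\<close> of
  \<open>PP QQ\<close>.\<close>

lemma idem_nonzero:
  assumes "a \<le> d"
  shows "idem a \<noteq> (\<lambda>x y. 0)"
proof
  assume 0: "idem a = (\<lambda>x y. 0)"
  have "QQ ! k ! a = 0" if k: "k \<le> d" for k
  proof -
    obtain x y where "x \<in> X" "y \<in> X" "cl x y = k" using cl_ex[OF k] by blast
    then show ?thesis using fun_cong[OF fun_cong[OF 0], of x y] card_pos by (simp add: idem_eq)
  qed
  then have "(\<Sum>k\<le>d. PP ! a ! k * QQ ! k ! a) = 0" by simp
  then show False using PQ[OF assms assms] card_pos by simp
qed

text \<open>Multiplication by \<open>idem a\<close> isolates the coordinate \<open>a\<close>, and
  \<open>idem a\<close> is nonzero; hence the idempotents are linearly independent.\<close>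

lemma lin_eq_iff: "lin b = lin c \<longleftrightarrow> (\<forall>m\<le>d. b m = c m)"
proof
  assume eq: "lin b = lin c"
  show "\<forall>m\<le>d. b m = c m"
  proof (intro allI impI)
    fix a assume a: "a \<le> d"
    have *: "matrix_product X (idem a) (lin f) = (\<lambda>x y. f a * idem a x y)" for f
      unfolding lin_delta[OF a, of "f a", symmetric] unfolding idem_lin[OF a] lin_product
      by (rule lin_cong) auto
    obtain x y where "idem a x y \<noteq> 0" using idem_nonzero[OF a] by (auto simp: fun_eq_iff)
    moreover have "b a * idem a x y = c a * idem a x y"
      using *[of b] *[of c] eq by metis
    ultimately show "b a = c a" by simp
  qed
qed (auto intro: lin_cong)

lemma zero_lin: "(\<lambda>x y. 0) = lin (\<lambda>m. 0)"
  by (simp add: lin_def)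

lemma lin_add: "(\<lambda>x y. lin b x y + lin c x y) = lin (\<lambda>m. b m + c m)"
  by (simp add: lin_def sum.distrib algebra_simps)

section \<open>Primitive idempotents and eigenmatrices\<close>

lemma idempotent_lin_iff:
  "idempotent_in X (bose_mesner_algebra d R) (lin c) \<longleftrightarrow> (\<forall>m\<le>d. c m = 0 \<or> c m = 1)"
  by (auto simp: idempotent_in_def bose_mesner_eq lin_product lin_eq_iff)

text \<open>Idempotents are the 0/1 vectors of coordinates, and orthogonal sums are disjoint unions
  of supports. The indecomposable ones therefore have a single coordinate in their support.\<close>

lemma primitive_idempotent_iff:
  "primitive_idempotent X (bose_mesner_algebra d R) E \<longleftrightarrow> E \<in> idem ` {..d}"
proof
  assume prim: "primitive_idempotent X (bose_mesner_algebra d R) E"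
  then obtain c where E: "E = lin c"
    by (auto simp: primitive_idempotent_def idempotent_in_def bose_mesner_eq)
  have c: "c m = 0 \<or> c m = 1" if "m \<le> d" for m
    using prim that unfolding E primitive_idempotent_def idempotent_lin_iff by blast
  have "E \<noteq> (\<lambda>x y. 0)" using prim by (simp add: primitive_idempotent_def)
  then obtain a where a: "a \<le> d" "c a \<noteq> 0" unfolding E zero_lin lin_eq_iff by auto
  with c have ca: "c a = 1" by auto
  \<comment> \<open>Split off one coordinate \<open>a\<close> of the support; primitivity forces the
    rest \<open>g\<close> to vanish.\<close>
  define g where "g m = (if m = a then 0 else c m)" for m
  have "idempotent_in X (bose_mesner_algebra d R) (idem a)"
    unfolding idem_lin[OF a(1)] idempotent_lin_iff by auto
  moreover have "idempotent_in X (bose_mesner_algebra d R) (lin g)"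
    unfolding idempotent_lin_iff using c by (auto simp: g_def)
  moreover have "matrix_product X (idem a) (lin g) = (\<lambda>x y. 0)"
    unfolding idem_lin[OF a(1)] lin_product zero_lin by (rule lin_cong) (simp add: g_def)
  moreover have "matrix_product X (lin g) (idem a) = (\<lambda>x y. 0)"
    unfolding idem_lin[OF a(1)] lin_product zero_lin by (rule lin_cong) (simp add: g_def)
  moreover have "E = (\<lambda>x y. idem a x y + lin g x y)"
    unfolding idem_lin[OF a(1)] lin_add E by (rule lin_cong) (simp add: g_def ca)
  ultimately have "lin g = (\<lambda>x y. 0)"
    using prim idem_nonzero[OF a(1)] unfolding primitive_idempotent_def by blast
  then have "\<forall>m\<le>d. g m = 0" unfolding zero_lin lin_eq_iff .
  then have "E = idem a"
    unfolding E idem_lin[OF a(1)] by (intro lin_cong) (auto simp: ca g_def split: if_splits)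
  then show "E \<in> idem ` {..d}" using a by auto
next
  assume "E \<in> idem ` {..d}"
  then obtain a where a: "a \<le> d" and E: "E = idem a" by auto
  show "primitive_idempotent X (bose_mesner_algebra d R) E"
    unfolding primitive_idempotent_def
  proof (intro conjI allI impI)
    show "idempotent_in X (bose_mesner_algebra d R) E"
      unfolding E idem_lin[OF a] idempotent_lin_iff by auto
    show "E \<noteq> (\<lambda>x y. 0)" using idem_nonzero[OF a] E by simp
  next
    fix F G
    assume *: "idempotent_in X (bose_mesner_algebra d R) F \<and>
       idempotent_in X (bose_mesner_algebra d R) G \<and>
       matrix_product X F G = (\<lambda>x y. 0) \<and> matrix_product X G F = (\<lambda>x y. 0) \<and>
       E = (\<lambda>x y. F x y + G x y)"
    then obtain f g where F: "F = lin f" and G: "G = lin g"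
      by (auto simp: idempotent_in_def bose_mesner_eq)
    have fg: "f m * g m = 0" "f m + g m = (if m = a then 1 else 0)" if "m \<le> d" for m
      using * that unfolding F G E idem_lin[OF a] lin_product lin_add zero_lin lin_eq_iff by auto
    have off: "f m = 0" "g m = 0" if "m \<le> d" "m \<noteq> a" for m
      using fg[OF that(1)] that(2) by (auto simp: add_eq_0_iff)
    from fg(1)[OF a] show "F = (\<lambda>x y. 0) \<or> G = (\<lambda>x y. 0)"
      unfolding F G zero_lin lin_eq_iff using off by (metis mult_eq_0_iff)
  qed
qed

lemma idem_bij: "bij_betw idem {..d} (primitive_idempotents X d R)"
proof -
  have "inj_on idem {..d}"
  proof (rule inj_onI)
    fix a b assume "a \<in> {..d}" "b \<in> {..d}" "idem a = idem b"
    then have "\<forall>m\<le>d. (if m = a then 1 else 0) = (if m = b then 1 else (0::complex))"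
      by (simp only: idem_lin lin_eq_iff atMost_iff)
    then show "a = b" using \<open>a \<in> {..d}\<close> by (metis atMost_iff zero_neq_one)
  qed
  moreover have "primitive_idempotents X d R = idem ` {..d}"
    by (auto simp: primitive_idempotents_def primitive_idempotent_iff)
  ultimately show ?thesis by (simp add: bij_betw_def)
qed

lemma first_eigenmatrix: "is_first_eigenmatrix d R idem PP"
  unfolding is_first_eigenmatrix_def by (auto simp: adjacency_lin lin_def)

lemma second_eigenmatrix: "is_second_eigenmatrix X d R idem QQ"
  unfolding is_second_eigenmatrix_def by (simp add: idem_def)

section \<open>Scheme axioms and imprimitivity\<close>

lemma symmetric_scheme: "symmetric_association_scheme X d R"
proof -
  have conv: "(R i)\<inverse> = R i" if "i \<le> d" for i
    using that cl_commute by (auto simp: R)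
  \<comment> \<open>The right-hand side depends only on \<open>i\<close>, \<open>j\<close>,
    \<open>k\<close>, and cancelling \<open>card X > 0\<close> makes the described number
    unique.\<close>
  define p where "p i j k = (THE c. real (card X) * real c =
      (\<Sum>m\<le>d. PP ! m ! i * PP ! m ! j * QQ ! k ! m))" for i j k
  have "card {z \<in> X. (x, z) \<in> R i \<and> (z, y) \<in> R j} = p i j k"
    if "i \<le> d" "j \<le> d" "k \<le> d" "(x, y) \<in> R k" for i j k x y
  proof -
    have xy: "x \<in> X" "y \<in> X" "cl x y = k" using that R by auto
    have eq: "{z \<in> X. (x, z) \<in> R i \<and> (z, y) \<in> R j} = {z \<in> X. cl x z = i \<and> cl z y = j}"
      using xy that by (auto simp: R)
    let ?c = "card {z \<in> X. cl x z = i \<and> cl z y = j}"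
    have c: "real (card X) * real ?c = (\<Sum>m\<le>d. PP ! m ! i * PP ! m ! j * QQ ! k ! m)"
      using count[OF xy(1,2) that(1,2)] xy(3) by simp
    show ?thesis
      unfolding p_def eq c[symmetric] using card_pos by (intro the_equality[symmetric]) simp_all
  qed
  then have "\<exists>p. \<forall>i\<le>d. \<forall>j\<le>d. \<forall>k\<le>d. \<forall>(x, y) \<in> R k.
      card {z \<in> X. (x, z) \<in> R i \<and> (z, y) \<in> R j} = p i j k" by blast
  moreover have "R 0 = Id_on X" using cl_eq_0 by (auto simp: R)
  moreover have "R i \<noteq> {}" if "i \<le> d" for i using cl_ex[OF that] that by (auto simp: R)
  moreover have "(\<Union>i\<le>d. R i) = X \<times> X"
  proof (intro equalityI subsetI)
    fix u assume "u \<in> X \<times> X"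
    then have "u \<in> R (cl (fst u) (snd u))" "cl (fst u) (snd u) \<le> d"
      using cl_le by (auto simp: R)
    then show "u \<in> (\<Union>i\<le>d. R i)" by blast
  qed (auto simp: R)
  ultimately show ?thesis
    unfolding symmetric_association_scheme_def association_scheme_def
    using fin ne conv by (auto simp: R)
qed

text \<open>The class \<open>i\<close> keeps the equivalence from being the diagonal, and the class
  \<open>j\<close> keeps it from being all of \<open>X \<times> X\<close>.\<close>

lemma imprimitive:
  assumes "I \<subseteq> {..d}" "equiv X {(x, y) \<in> X \<times> X. cl x y \<in> I}"
    and "i \<in> I" "i \<noteq> 0" "j \<le> d" "j \<notin> I"
  shows "imprimitive_scheme X d R"
proof -
  have un: "(\<Union>i\<in>I. R i) = {(x, y) \<in> X \<times> X. cl x y \<in> I}"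
    using assms(1) by (auto simp: R subset_iff)
  obtain x y where "x \<in> X" "y \<in> X" "cl x y = i" using cl_ex[of i] assms by auto
  then have "(x, y) \<in> (\<Union>i\<in>I. R i)" "(x, y) \<notin> Id_on X"
    unfolding un using assms(3,4) cl_eq_0[of x y] by auto
  then have "(\<Union>i\<in>I. R i) \<noteq> Id_on X" by blast
  moreover obtain u v where "u \<in> X" "v \<in> X" "cl u v = j" using cl_ex[of j] assms by auto
  then have "(\<Union>i\<in>I. R i) \<noteq> X \<times> X" unfolding un using assms(6) by auto
  ultimately show ?thesis
    unfolding imprimitive_scheme_def using assms(1,2) un by metis
qed

end

section \<open>The field with \<open>q\<^sup>2\<close> elements and its Hermitian plane\<close>

text \<open>Root bound for a polynomial of degree \<open>n\<close>. It bounds the fixed field, the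
  fibres of the trace, and (with \<open>a = 0\<close>) the fibres of the norm.\<close>

lemma card_power_eq_linear_le:
  fixes a b :: "'a::field"
  assumes "n \<ge> 2"
  shows "finite {x. x ^ n = a * x + b}" "card {x. x ^ n = a * x + b} \<le> n"
proof -
  define p where "p = Polynomial.monom 1 n + [:- b, - a:]"
  have deg: "degree [:- b, - a:] < n" using assms by (auto simp: degree_pCons_eq_if)
  have "degree p = n"
    unfolding p_def using deg by (subst degree_add_eq_left) (auto simp: degree_monom_eq)
  moreover from this assms have "p \<noteq> 0" by auto
  moreover have "{x. poly p x = 0} = {x. x ^ n = a * x + b}"
    by (auto simp: p_def poly_monom algebra_simps eq_neg_iff_add_eq_0 add_eq_0_iff)
  ultimately show "finite {x. x ^ n = a * x + b}" "card {x. x ^ n = a * x + b} \<le> n"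
    using card_poly_roots_bound[of p] poly_roots_finite[of p] by auto
qed

text \<open>If \<open>f\<close> parametrises the solutions of \<open>P\<close>, a further condition
  \<open>Q\<close> can be imposed on the parameter instead.\<close>

lemma Collect_eq_image:
  assumes "\<And>a. P a \<Longrightarrow> a \<in> range f" "\<And>m. P (f m)"
  shows "{a. Q a \<and> P a} = f ` {m. Q (f m)}"
  using assms by blast

text \<open>At most \<open>k\<close> fibres of size at most \<open>m\<close> cover
  \<open>k * m\<close> elements, so both bounds are attained. This turns root bounds into
  equidistribution.\<close>

lemma card_fibres_tight:
  assumes "finite A" "finite B" "f ` A \<subseteq> B" "card B \<le> k" "card A = k * m" "m > 0"
    and fib: "\<And>b. b \<in> B \<Longrightarrow> card {a \<in> A. f a = b} \<le> m"
  shows "card B = k" "\<And>b. b \<in> B \<Longrightarrow> card {a \<in> A. f a = b} = m"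
proof -
  have A: "card A = (\<Sum>b\<in>B. card {a \<in> A. f a = b})"
    using sum.group[of A B f "\<lambda>_. 1::nat"] assms(1-3) by simp
  also have "\<dots> \<le> card B * m" using sum_mono[of B _ "\<lambda>_. m"] fib by simp
  finally have "k * m \<le> card B * m" using assms(5) by simp
  then show k: "card B = k" using assms(4,6) by simp
  show "card {a \<in> A. f a = b} = m" if b: "b \<in> B" for b
  proof (rule ccontr)
    assume "card {a \<in> A. f a = b} \<noteq> m"
    with fib[OF b] have "card {a \<in> A. f a = b} < m" by simp
    then have "(\<Sum>b\<in>B. card {a \<in> A. f a = b}) < (\<Sum>b\<in>B. m)"
      using assms(2) b fib by (intro sum_strict_mono_ex1) auto
    then show False using A k assms(5) by simp
  qed
qed

locale hermitian_field =
  fixes q :: nat and K :: "'a::{field,finite} itself"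
  assumes primepow: "primepow q" and odd: "odd q" and card_K: "CARD('a) = q ^ 2"
begin

definition cj :: "'a \<Rightarrow> 'a" where "cj x = x ^ q"

lemma CHAR_dvd_q: "CHAR('a) dvd q" and prime_CHAR: "prime CHAR('a)"
proof -
  show p: "prime CHAR('a)" by (rule prime_CHAR_semidom) (simp add: finite_imp_CHAR_pos)
  have "CHAR('a) dvd q ^ 2" using CHAR_dvd_CARD[where 'a = 'a] card_K by simp
  then show "CHAR('a) dvd q" using p prime_dvd_power by blast
qed

lemma q_gt_2: "q > 2"
  using primepow_gt_Suc_0[OF primepow] odd by (cases "q = 2") auto

text \<open>The Frobenius identity holds for powers of the characteristic, so the prime below
  \<open>q\<close> is first identified with \<open>CHAR('a)\<close>.\<close>

lemma cj_add [simp]: "cj (x + y) = cj x + cj y"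
proof -
  obtain p k where "prime p" "k > 0" "q = p ^ k" using primepow by (auto simp: primepow_def)
  moreover have "CHAR('a) dvd p"
    using CHAR_dvd_q prime_CHAR \<open>q = p ^ k\<close> prime_dvd_power by blast
  ultimately have "q = CHAR('a) ^ k"
    using prime_CHAR primes_dvd_imp_eq by blast
  then show ?thesis
    unfolding cj_def by (rule freshmans_dream'[OF prime_CHAR])
qed

lemma cj_mult [simp]: "cj (x * y) = cj x * cj y"
  by (simp add: cj_def power_mult_distrib)

lemma cj_divide [simp]: "cj (x / y) = cj x / cj y"
  by (simp add: cj_def power_divide)

lemma cj_0 [simp]: "cj 0 = 0" and cj_1 [simp]: "cj 1 = 1"
  using q_gt_2 by (auto simp: cj_def)

lemma cj_minus [simp]: "cj (- x) = - cj x"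
  using odd by (simp add: cj_def)

lemma cj_diff [simp]: "cj (x - y) = cj x - cj y"
  using cj_add[of x "- y"] by simp

lemma cj_eq_0_iff [simp]: "cj x = 0 \<longleftrightarrow> x = 0"
  using q_gt_2 by (simp add: cj_def)

lemma cj_cj [simp]: "cj (cj x) = x"
  using power_card_field[of x] by (simp add: cj_def card_K power2_eq_square flip: power_mult)

lemma two_nonzero [simp]: "(2::'a) \<noteq> 0"
proof
  assume "(2::'a) = 0"
  then have "CHAR('a) dvd 2" by (metis of_nat_eq_0_iff_char_dvd of_nat_numeral)
  then have "CHAR('a) = 2" using prime_CHAR primes_dvd_imp_eq two_is_prime_nat by blast
  then show False using CHAR_dvd_q odd by simp
qed

lemma cj_2 [simp]: "cj 2 = 2"
  using cj_add[of 1 1] by simp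

section \<open>Equidistribution of trace and norm\<close>

definition fixed :: "'a set" where "fixed = {x. cj x = x}"

definition skew :: "'a set" where "skew = {x. cj x = - x}"

lemma neg_eq_self_iff: "- x = x \<longleftrightarrow> x = (0::'a)"
proof
  assume "- x = x"
  then have "2 * x = 0" by (metis mult_2 add.right_inverse)
  then show "x = 0" by simp
qed simp

lemma fixed_skew_0: "x \<in> fixed \<Longrightarrow> x \<in> skew \<Longrightarrow> x = 0"
  using neg_eq_self_iff[of x] by (simp add: fixed_def skew_def)

text \<open>The trace maps the \<open>q * q\<close> elements of the field into \<open>fixed\<close>.
  Both \<open>fixed\<close> and each fibre are root sets of polynomials of degree \<open>q\<close>,
  so \<open>card_fibres_tight\<close> applies with both bounds equal to \<open>q\<close>.\<close>

lemma 
  shows card_fixed: "card fixed = q"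
    and card_trace: "t \<in> fixed \<Longrightarrow> card {x. x + cj x = t} = q"
proof -
  have *: "f ` (UNIV :: 'a set) \<subseteq> fixed" if "f = (\<lambda>x. x + cj x)" for f
    using that by (auto simp: fixed_def add.commute)
  have F: "card fixed \<le> q"
    using card_power_eq_linear_le(2)[of q 1 "0::'a"] q_gt_2 by (simp add: fixed_def cj_def)
  have fib: "card {x. x \<in> UNIV \<and> x + cj x = t} \<le> q" for t :: 'a
  proof -
    have "{x. x \<in> UNIV \<and> x + cj x = t} = {x. x ^ q = (- 1) * x + t}"
      by (auto simp: cj_def algebra_simps)
    then show ?thesis using card_power_eq_linear_le(2)[of q "- 1" t] q_gt_2 by simp
  qed
  show "card fixed = q"
    using card_fibres_tight(1)[OF _ _ *[OF refl] F, of q] fib q_gt_2 card_K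
    by (simp add: power2_eq_square)
  show "card {x. x + cj x = t} = q" if "t \<in> fixed"
    using card_fibres_tight(2)[OF _ _ *[OF refl] F, of q t] fib q_gt_2 card_K that
    by (simp add: power2_eq_square)
qed

lemma card_skew: "card skew = q"
proof -
  have "skew = {x. x + cj x = 0}" by (auto simp: skew_def add_eq_0_iff)
  then show ?thesis using card_trace[of 0] by (simp add: fixed_def)
qed

text \<open>The norm maps the \<open>(q - 1) * (q + 1)\<close> nonzero elements into the at most
  \<open>q - 1\<close> nonzero fixed ones, with fibres of size at most \<open>q + 1\<close>; hence
  all bounds are attained.\<close>

lemma card_norm:
  assumes "t \<in> fixed"
  shows "card {x. x * cj x = t} = (if t = 0 then 1 else q + 1)"
proof (cases "t = 0")
  case False
  have im: "(\<lambda>x. x * cj x) ` (UNIV - {0}) \<subseteq> fixed - {0}"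
    by (auto simp: fixed_def mult.commute)
  have F: "card (fixed - {0}) \<le> q - 1"
    using card_fixed by (simp add: fixed_def)
  have K: "card (UNIV - {0::'a}) = (q - 1) * (q + 1)"
    by (simp add: card_Diff_singleton card_K power2_eq_square algebra_simps)
  have fib: "card {x \<in> UNIV - {0}. x * cj x = s} \<le> q + 1" for s :: 'a
  proof -
    have "card {x \<in> UNIV - {0}. x * cj x = s} \<le> card {x. x ^ (q + 1) = 0 * x + s}"
      by (intro card_mono) (auto simp: cj_def)
    also have "\<dots> \<le> q + 1" using q_gt_2 by (intro card_power_eq_linear_le) simp
    finally show ?thesis .
  qed
  have "card {x \<in> UNIV - {0}. x * cj x = t} = q + 1"
    by (rule card_fibres_tight(2)[OF _ _ im F K _ fib]) (use False assms in auto)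
  moreover have "{x \<in> UNIV - {0}. x * cj x = t} = {x. x * cj x = t}" using False by auto
  ultimately show ?thesis using False by simp
qed simp

section \<open>Vectors of the Hermitian plane with prescribed inner products\<close>

definition ip :: "'a \<times> 'a \<Rightarrow> 'a \<times> 'a \<Rightarrow> 'a" where
  "ip v w = fst v * cj (fst w) + snd v * cj (snd w)"

lemma ip_add: "ip (u + v) w = ip u w + ip v w" "ip u (v + w) = ip u v + ip u w"
  and ip_diff: "ip (u - v) w = ip u w - ip v w" "ip u (v - w) = ip u v - ip u w"
  and ip_0 [simp]: "ip 0 w = 0" "ip u 0 = 0"
  by (simp_all add: ip_def algebra_simps)

lemma cj_ip [simp]: "cj (ip v w) = ip w v"
  by (simp add: ip_def algebra_simps)

lemma ip_self_fixed: "ip v v \<in> fixed"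
  by (simp add: fixed_def)

lemma card_ip_eq:
  assumes "b \<noteq> 0"
  shows "card {a. ip a b = t} = q ^ 2"
proof -
  obtain b1 b2 where b: "b = (b1, b2)" by force
  show ?thesis
  proof (cases "b1 = 0")
    case True
    with assms b have b2: "b2 \<noteq> 0" by (auto simp: zero_prod_def)
    have "{a. ip a b = t} = range (\<lambda>x. (x, t / cj b2))"
      using b b2 True by (auto simp: ip_def image_iff field_simps)
    then show ?thesis by (simp add: card_image inj_on_def card_K)
  next
    case False
    have "{a. ip a b = t} = range (\<lambda>x. ((t - x * cj b2) / cj b1, x))"
      using b False by (auto simp: ip_def image_iff field_simps)
    then show ?thesis by (simp add: card_image inj_on_def card_K)
  qed
qed

text \<open>For each first coordinate \<open>x\<close>, the second must have norm
  \<open>- (x * cj x)\<close>: one choice for \<open>x = 0\<close>, otherwise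
  \<open>q + 1\<close>.\<close>

lemma card_isotropic: "card {a. ip a a = 0} = q ^ 3 + q ^ 2 - q"
proof -
  have "{a. ip a a = 0} = (SIGMA x:UNIV. {y. y * cj y = - (x * cj x)})"
    by (auto simp: ip_def add_eq_0_iff)
  then have "card {a. ip a a = 0} = (\<Sum>x\<in>UNIV. card {y. y * cj y = - (x * cj x)})"
    by simp
  also have "\<dots> = (\<Sum>x\<in>UNIV. if x = (0::'a) then 1 else q + 1)"
  proof (intro sum.cong refl)
    fix x :: 'a
    have "- (x * cj x) \<in> fixed" by (simp add: fixed_def mult.commute)
    from card_norm[OF this] show "card {y. y * cj y = - (x * cj x)} = (if x = 0 then 1 else q + 1)"
      by simp
  qed
  also have "\<dots> = 1 + (\<Sum>x\<in>UNIV - {0::'a}. q + 1)"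
    by (subst sum.remove[of _ 0]) auto
  also have "\<dots> = 1 + (q ^ 2 - 1) * (q + 1)"
    by (simp add: card_Diff_singleton card_K)
  also have "\<dots> = q ^ 3 + q ^ 2 - q"
    using q_gt_2 by (cases q) (auto simp: algebra_simps power2_eq_square power3_eq_cube)
  finally show ?thesis .
qed

text \<open>Decompose \<open>a\<close> along \<open>b\<close> and its orthogonal complement. The
  component along \<open>b\<close> is fixed by \<open>t\<close>, and isotropy prescribes the norm of
  the other coefficient, so \<open>card_norm\<close> counts the solutions.\<close>

lemma card_isotropic_ip_anisotropic:
  assumes b: "ip b b \<noteq> 0"
  shows "card {a. ip a a = 0 \<and> ip a b = t} = (if t = 0 then 1 else q + 1)"
proof -
  obtain b1 b2 where b12: "b = (b1, b2)" by force
  define n where "n = ip b b"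
  have n: "n \<noteq> 0" "cj n = n" "n = b1 * cj b1 + b2 * cj b2"
    using b by (simp_all add: n_def) (simp add: ip_def b12)
  define u where "u = t / n"
  \<comment> \<open>The vector \<open>(- cj b2, cj b1)\<close> is orthogonal to \<open>b\<close> and
    has the same norm \<open>n\<close>.\<close>
  define f where "f m = (u * b1 - m * cj b2, u * b2 + m * cj b1)" for m
  have "ip (f m) b = u * n" for m
    unfolding n(3) by (simp add: f_def ip_def b12 algebra_simps)
  then have ipf: "ip (f m) b = t" for m
    using n(1) by (simp add: u_def)
  have Nf: "ip (f m) (f m) = (u * cj u + m * cj m) * n" for m
    unfolding n(3) f_def ip_def by (simp add: algebra_simps)
  have surj: "a \<in> range f" if "ip a b = t" for a
  proof -
    have t: "t = fst a * cj b1 + snd a * cj b2" using that by (simp add: ip_def b12)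
    \<comment> \<open>The inner product of \<open>a\<close> with \<open>(- cj b2, cj b1)\<close>,
      divided by its norm \<open>n\<close>.\<close>
    define m where "m = (snd a * b1 - fst a * b2) / n"
    have "n * (u * b1 - m * cj b2) = t * b1 - (snd a * b1 - fst a * b2) * cj b2"
      "n * (u * b2 + m * cj b1) = t * b2 + (snd a * b1 - fst a * b2) * cj b1"
      using n(1) by (simp_all add: u_def m_def distrib_left right_diff_distrib)
    then have "n * (u * b1 - m * cj b2) = n * fst a" "n * (u * b2 + m * cj b1) = n * snd a"
      unfolding t n(3) by (simp_all add: algebra_simps)
    then have "a = f m" using n(1) by (simp add: f_def prod_eq_iff)
    then show ?thesis by blast
  qed
  have inj: "inj f"
    using n(1) unfolding n(3) by (auto simp: inj_on_def f_def)
  have "ip (f m) (f m) = 0 \<longleftrightarrow> m * cj m = - (u * cj u)" for m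
    using n(1) by (simp add: Nf add_eq_0_iff)
  then have "{a. ip a a = 0 \<and> ip a b = t} = f ` {m. m * cj m = - (u * cj u)}"
    by (subst Collect_eq_image[of "\<lambda>a. ip a b = t" f, OF surj ipf]) auto
  then have "card {a. ip a a = 0 \<and> ip a b = t} = card {m. m * cj m = - (u * cj u)}"
    using inj by (simp add: card_image inj_on_subset)
  also have "\<dots> = (if t = 0 then 1 else q + 1)"
    using n(1) by (subst card_norm) (auto simp: fixed_def u_def mult.commute)
  finally show ?thesis .
qed

text \<open>The direction orthogonal to \<open>b\<close> is now itself isotropic, so the term
  quadratic in the parameter disappears. What remains is a trace equation: void for
  \<open>t = 0\<close>, with \<open>q\<close> solutions otherwise.\<close>

lemma card_isotropic_ip_isotropic:
  assumes b: "b \<noteq> 0" "ip b b = 0"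
  shows "card {a. ip a a = 0 \<and> ip a b = t} = (if t = 0 then q ^ 2 else q)"
proof -
  obtain b1 b2 where b12: "b = (b1, b2)" by force
  have n: "b1 * cj b1 + b2 * cj b2 = 0" using b by (simp add: ip_def b12)
  \<comment> \<open>By \<open>n\<close> the norms of the two coordinates are opposite, so if one
    coordinate vanished the other would too.\<close>
  have nz: "b1 \<noteq> 0" "b2 \<noteq> 0" using n b(1) by (auto simp: b12 zero_prod_def)
  \<comment> \<open>The point \<open>(t / cj b1, 0)\<close> solves \<open>ip a b = t\<close>; the
    direction is again \<open>(- cj b2, cj b1)\<close>.\<close>
  define f where "f m = (t / cj b1 - m * cj b2, m * cj b1)" for m
  have ipf: "ip (f m) b = t" for m
    using nz by (simp add: f_def ip_def b12 field_simps)
  have Nf: "ip (f m) (f m) = t * cj t / (b1 * cj b1) - (m * (cj t * cj b2 / b1) + cj (m * (cj t * cj b2 / b1)))" for m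
  proof -
    define u where "u = t / cj b1"
    have t: "t = u * cj b1" using nz by (simp add: u_def)
    have "ip (f m) (f m) = u * cj u - (m * cj u * cj b2 + cj m * u * b2)
        + m * cj m * (b1 * cj b1 + b2 * cj b2)"
      by (simp add: f_def ip_def u_def[symmetric] algebra_simps)
    then show ?thesis using nz by (simp add: n t)
  qed
  have surj: "a \<in> range f" if "ip a b = t" for a
  proof -
    have "a = f (snd a / cj b1)"
      using that nz unfolding f_def ip_def b12
      by (cases a) (auto simp: field_simps)
    then show ?thesis by blast
  qed
  have inj: "inj f"
    using nz by (auto simp: inj_on_def f_def)
  have "{a. ip a a = 0 \<and> ip a b = t} = f ` {m. m * (cj t * cj b2 / b1) + cj (m * (cj t * cj b2 / b1)) = t * cj t / (b1 * cj b1)}"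
    by (subst Collect_eq_image[of "\<lambda>a. ip a b = t" f, OF surj ipf]) (auto simp: Nf simp del: cj_mult cj_divide)
  then have *: "card {a. ip a a = 0 \<and> ip a b = t} =
      card {m. m * (cj t * cj b2 / b1) + cj (m * (cj t * cj b2 / b1)) = t * cj t / (b1 * cj b1)}"
    using inj by (simp add: card_image inj_on_subset)
  show ?thesis
  proof (cases "t = 0")
    case True
    with * show ?thesis by (simp add: card_K)
  next
    case False
    define c where "c = cj t * cj b2 / b1"
    have c: "c \<noteq> 0" using nz False by (simp add: c_def)
    define r where "r = t * cj t / (b1 * cj b1)"
    have "bij_betw (\<lambda>m. m * c) {m. m * c + cj (m * c) = r} {x. x + cj x = r}"
      by (rule bij_betwI[where g = "\<lambda>x. x / c"]) (use c in auto)
    then have "card {m. m * c + cj (m * c) = r} = q"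
      using card_trace[of r] bij_betw_same_card by (force simp: fixed_def r_def mult.commute)
    then show ?thesis using * False by (simp add: c_def r_def)
  qed
qed

end

section \<open>Counting in the Heisenberg group\<close>

lemma card_eq_sum_fibres:
  "finite A \<Longrightarrow> finite B \<Longrightarrow> f ` A \<subseteq> B \<Longrightarrow> card A = (\<Sum>b\<in>B. card {a \<in> A. f a = b})"
  using sum.group[of A B f "\<lambda>_. 1::nat"] by simp

lemma le_5_cases: "k \<le> (5::nat) \<Longrightarrow> k = 0 \<or> k = 1 \<or> k = 2 \<or> k = 3 \<or> k = 4 \<or> k = 5"
  by arith

lemma sum_atMost_5:
  "(\<Sum>k\<le>5. f k) = f 0 + f 1 + f 2 + f 3 + f 4 + f (5::nat)" for f :: "nat \<Rightarrow> real"
  by (simp add: eval_nat_numeral add.assoc)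

text \<open>Entry \<open>[k, l, c]\<close> of the two tables is \<open>twisted k l\<close> or \<open>plain k l\<close> (defined below) for a pair
  of class \<open>c\<close>. Only \<open>k \<le> l\<close> is needed in the first one, hence the empty lists.\<close>

definition twisted_table :: "real \<Rightarrow> real list list list" where
  "twisted_table r =
    [[[1, 0, 0, 0, 0, 0], [1, 1, 0, 0, 0, 0], [1, 1, 0, 0, 0, 1]],
     [[], [r^3 + r^2 - r, r^2, 0, r, r + 1, r + 1],
      [r^3 + r^2 - r, 2 * r^2 - r, 0, r^2, r^2 + r, r^2]],
     [[], [], [r^4, r^3, 0, r^3, r^3, r^3]]]"

definition plain_table :: "real \<Rightarrow> real list list list" where
  "plain_table r =
    [[[1, 0, 1, 0, 0, 0], [1, 1, 1, 1, 0, 0], [1, 1, 1, 1, 1, 1]],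
     [[1, 1, 1, 1, 0, 0],
      [r^3 + r^2 - r, 2 * r^2 - r, r^3 + r^2 - r, 2 * r^2 - r, r^2 + r, r^2 + r],
      replicate 6 (r^3 + r^2 - r)],
     [[1, 1, 1, 1, 1, 1], replicate 6 (r^3 + r^2 - r), replicate 6 (r^4)]]"

context hermitian_field
begin

section \<open>Skew parts and the counts \<open>twisted\<close> and \<open>plain\<close>\<close>

definition sk :: "'a \<Rightarrow> 'a" where "sk x = (x - cj x) / 2"

lemma sk_add: "sk (x + y) = sk x + sk y" and sk_diff: "sk (x - y) = sk x - sk y"
  and sk_0 [simp]: "sk 0 = 0" and sk_cj: "sk (cj x) = - sk x"
  by (simp_all add: sk_def diff_divide_distrib add_divide_distrib)

lemma sk_skew [simp]: "sk x \<in> skew"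
  by (simp add: sk_def skew_def diff_divide_distrib)

lemma sk_eq_iff: "b \<in> skew \<Longrightarrow> sk x = b \<longleftrightarrow> x - b \<in> fixed"
proof -
  assume b: "b \<in> skew"
  have "sk x = b \<longleftrightarrow> x - cj x = b * 2" by (simp add: sk_def divide_eq_eq)
  also have "\<dots> \<longleftrightarrow> x - b = cj x + b"
  proof -
    have "(x - b) - (cj x + b) = (x - cj x) - b * 2" by (simp add: algebra_simps)
    then show ?thesis by (metis right_minus_eq)
  qed
  also have "\<dots> \<longleftrightarrow> x - b \<in> fixed" using b by (auto simp: fixed_def skew_def)
  finally show ?thesis .
qed

lemma sk_ip_self [simp]: "sk (ip v v) = 0"
  by (simp add: sk_def)

lemma sk_ip_swap: "sk (ip w v) = - sk (ip v w)"
  using sk_cj[of "ip v w"] by simp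

text \<open>Every element is half its trace plus its skew part, so the two together determine
  it.\<close>

lemma trace_sk_iff:
  assumes "n \<in> fixed" "b \<in> skew"
  shows "x + cj x = n \<and> sk x = b \<longleftrightarrow> x = n / 2 + b"
proof
  assume *: "x + cj x = n \<and> sk x = b"
  then have "n / 2 + b = (x + cj x) / 2 + (x - cj x) / 2" by (auto simp: sk_def)
  also have "\<dots> = (2 * x) / 2" by (simp only: add_divide_distrib[symmetric]) simp
  finally show "x = n / 2 + b" by simp
next
  assume x: "x = n / 2 + b"
  have cjx: "cj x = n / 2 - b"
    using assms by (simp add: x fixed_def skew_def)
  then have "x + cj x = n / 2 + n / 2" "x - cj x = 2 * b" by (simp_all add: x)
  moreover have "n / 2 + n / 2 = n" by (simp only: add_divide_distrib[symmetric]) simp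
  ultimately show "x + cj x = n \<and> sk x = b" by (simp add: sk_def)
qed

lemma ip_self_diff: "ip (b - a) (b - a) = ip b b + ip a a - (ip a b + cj (ip a b))"
  by (simp add: ip_diff)

lemma ip_self_minus [simp]: "ip (- a) (- a) = ip a a"
  by (simp add: ip_def)

text \<open>As \<open>fixed\<close> and \<open>skew\<close> meet only in 0, the exceptional value
  \<open>m\<close> is taken only for \<open>b = 0\<close>, and then only at
  \<open>t = 0\<close>.\<close>

lemma sum_fixed:
  assumes "b \<in> skew"
  shows "(\<Sum>t\<in>fixed. if t + b = 0 then m else n) = (if b = 0 then m + (q - 1) * n else q * (n::nat))"
proof (cases "b = 0")
  case True
  have "(\<Sum>t\<in>fixed. if t = 0 then m else n) = m + (\<Sum>t\<in>fixed - {0}. n)"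
    by (subst sum.remove[of _ 0]) (auto simp: fixed_def)
  also have "\<dots> = m + (q - 1) * n"
    using card_fixed by (simp add: card_Diff_singleton fixed_def)
  finally show ?thesis using True by simp
next
  case False
  have "t + b \<noteq> 0" if "t \<in> fixed" for t
  proof
    assume "t + b = 0"
    then have "b = - t" by (simp add: add_eq_0_iff)
    with that have "b \<in> fixed" by (simp add: fixed_def)
    with fixed_skew_0 assms False show False by blast
  qed
  then show ?thesis using False card_fixed by simp
qed

lemma card_sk_eq_sum:
  assumes "b \<in> skew"
  shows "card {a. P a \<and> sk (g a) = b} = (\<Sum>t\<in>fixed. card {a. P a \<and> g (a::'a \<times> 'a) = t + b})"
proof -
  have "card {a. P a \<and> sk (g a) = b} =
      (\<Sum>t\<in>fixed. card {a \<in> {a. P a \<and> sk (g a) = b}. g a - b = t})"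
    by (rule card_eq_sum_fibres) (auto simp: sk_eq_iff[OF assms])
  also have "\<dots> = (\<Sum>t\<in>fixed. card {a. P a \<and> g a = t + b})"
    by (intro sum.cong refl arg_cong[where f = card]) (auto simp: sk_eq_iff[OF assms] algebra_simps)
  finally show ?thesis .
qed

text \<open>Cumulative types: each condition implies the next, matching the nested basis used for
  the products below.\<close>

definition type_le :: "nat \<Rightarrow> 'a \<times> 'a \<Rightarrow> bool" where
  "type_le k a \<longleftrightarrow> (if k = 0 then a = 0 else if k = 1 then ip a a = 0 else True)"

lemma type_le_simps [simp]:
  "type_le 0 a \<longleftrightarrow> a = 0" "type_le 1 a \<longleftrightarrow> ip a a = 0" "type_le (Suc 0) a \<longleftrightarrow> ip a a = 0" "type_le 2 a"
  by (simp_all add: type_le_def)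

text \<open>The number of the relation, where \<open>b\<close> is the difference of the vectors and
  \<open>s\<close> the skew part of the form value.\<close>

definition cls :: "'a \<times> 'a \<Rightarrow> 'a \<Rightarrow> nat" where
  "cls b s = (if b = 0 then (if s = 0 then 0 else 2)
     else if ip b b = 0 then (if s = 0 then 1 else 3) else (if s = 0 then 5 else 4))"

text \<open>Counts the intermediate points when both steps are required to have skew part 0; the
  cocycle turns the second requirement into a condition on \<open>ip a b\<close>. Its companion
  \<open>plain\<close> serves when at most one step carries that requirement.\<close>

definition twisted :: "nat \<Rightarrow> nat \<Rightarrow> 'a \<times> 'a \<Rightarrow> 'a \<Rightarrow> nat" where
  "twisted k l b s = card {a. (type_le k a \<and> type_le l (b - a)) \<and> sk (ip a b) = s}"

definition plain :: "nat \<Rightarrow> nat \<Rightarrow> 'a \<times> 'a \<Rightarrow> nat" where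
  "plain k l b = card {a. type_le k a \<and> type_le l (b - a)}"

lemma real_card_isotropic: "real (card {a. ip a a = 0}) = real q ^ 3 + real q ^ 2 - real q"
proof -
  have "q \<le> q ^ 3 + q ^ 2" using q_gt_2 by (simp add: power2_eq_square trans_le_add2)
  then show ?thesis by (simp add: card_isotropic of_nat_diff)
qed

lemma real_q_minus_1: "real (q - 1) = real q - 1"
  using q_gt_2 by simp

lemma real_q_identities:
  "real (q ^ 2 + (q - 1) * q) = 2 * real q ^ 2 - real q"
  "real (1 + (q - 1) * (q + 1)) = real q ^ 2"
  by (simp_all only: of_nat_add of_nat_mult of_nat_power real_q_minus_1)
     (simp_all add: algebra_simps power2_eq_square)

lemma card_prod_K: "CARD('a \<times> 'a) = q ^ 4"
  by (simp add: card_K flip: power_add)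

lemma twisted_zero: "twisted 0 l b s = of_bool (type_le l b \<and> s = 0)"
proof -
  have "{a. (type_le 0 a \<and> type_le l (b - a)) \<and> sk (ip a b) = s} =
      (if type_le l b \<and> s = 0 then {0} else {})" by auto
  then show ?thesis by (simp add: twisted_def)
qed

lemma twisted_at_0: "twisted k l 0 s = (if s = 0 then plain k l 0 else 0)"
  by (simp add: twisted_def plain_def)

text \<open>For isotropic \<open>a\<close>, isotropy of \<open>b - a\<close> prescribes the trace of
  \<open>ip a b\<close>. With the skew part \<open>s\<close> this gives
  \<open>ip a b = ip b b / 2 + s\<close>, a value that is nonzero when \<open>b\<close> is
  anisotropic.\<close>

lemma twisted_iso_iso:
  assumes "s \<in> skew" "b \<noteq> 0"
  shows "twisted 1 1 b s = (if ip b b = 0 then (if s = 0 then q ^ 2 else q) else q + 1)"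
proof -
  have "type_le 1 a \<and> type_le 1 (b - a) \<longleftrightarrow> ip a a = 0 \<and> ip a b + cj (ip a b) = ip b b" for a
    unfolding type_le_simps ip_self_diff by (metis add.right_neutral right_minus_eq)
  then have "{a. (type_le 1 a \<and> type_le 1 (b - a)) \<and> sk (ip a b) = s} =
      {a. ip a a = 0 \<and> ip a b = ip b b / 2 + s}"
    unfolding trace_sk_iff[OF ip_self_fixed[of b] assms(1), symmetric] by blast
  moreover have "ip b b / 2 + s \<noteq> 0" if "ip b b \<noteq> 0"
  proof
    assume "ip b b / 2 + s = 0"
    then have "s = - (ip b b / 2)" by (simp add: add_eq_0_iff)
    then have "s \<in> fixed" by (simp add: fixed_def)
    with \<open>ip b b / 2 + s = 0\<close> that fixed_skew_0 assms(1) show False by force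
  qed
  ultimately show ?thesis
    using assms(2) card_isotropic_ip_isotropic card_isotropic_ip_anisotropic
    by (simp add: twisted_def)
qed

text \<open>Only the skew part of \<open>ip a b\<close> is prescribed, so the counts of isotropic
  vectors are summed over its \<open>q\<close> possible fixed parts.\<close>

lemma twisted_iso_any:
  assumes "s \<in> skew" "b \<noteq> 0"
  shows "real (twisted 1 2 b s) =
    (if ip b b = 0 then (if s = 0 then 2 * real q ^ 2 - real q else real q ^ 2)
     else (if s = 0 then real q ^ 2 else real q ^ 2 + real q))"
proof -
  have "twisted 1 2 b s = (\<Sum>t\<in>fixed. card {a. ip a a = 0 \<and> ip a b = t + s})"
    unfolding twisted_def by (subst card_sk_eq_sum[OF assms(1)]) simp
  also have "\<dots> = (\<Sum>t\<in>fixed. if t + s = 0 then (if ip b b = 0 then q ^ 2 else 1)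
      else (if ip b b = 0 then q else q + 1))"
    using card_isotropic_ip_isotropic[OF assms(2)] card_isotropic_ip_anisotropic[of b]
    by (intro sum.cong refl) auto
  also have "\<dots> = (if ip b b = 0 then (if s = 0 then q ^ 2 + (q - 1) * q else q * q)
      else (if s = 0 then 1 + (q - 1) * (q + 1) else q * (q + 1)))"
    by (simp add: sum_fixed[OF assms(1)])
  finally have *: "twisted 1 2 b s =
    (if ip b b = 0 then (if s = 0 then q ^ 2 + (q - 1) * q else q * q)
      else (if s = 0 then 1 + (q - 1) * (q + 1) else q * (q + 1)))" .
  show ?thesis
    unfolding * using real_q_identities by (auto simp only: split: if_split)
      (simp_all add: power2_eq_square algebra_simps)
qed

lemma twisted_any_any:
  assumes "s \<in> skew" "b \<noteq> 0"
  shows "twisted 2 2 b s = q ^ 3"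
  unfolding twisted_def
  by (subst card_sk_eq_sum[OF assms(1)])
     (simp add: card_ip_eq[OF assms(2)] card_fixed power3_eq_cube power2_eq_square)

lemma plain_commute: "plain k l b = plain l k b"
proof -
  have "bij_betw (\<lambda>a. b - a) {a. type_le k a \<and> type_le l (b - a)}
      {a. type_le l a \<and> type_le k (b - a)}"
    by (rule bij_betwI[where g = "\<lambda>a. b - a"]) auto
  then show ?thesis unfolding plain_def by (rule bij_betw_same_card)
qed

lemma plain_zero: "plain 0 l b = of_bool (type_le l b)"
proof -
  have "{a. type_le 0 a \<and> type_le l (b - a)} = (if type_le l b then {0} else {})" by auto
  then show ?thesis by (simp add: plain_def)
qed

text \<open>For \<open>b \<noteq> 0\<close> this is the sum of \<open>twisted 1 1 b s\<close> over
  all skew \<open>s\<close>; for \<open>b = 0\<close> it is the number of isotropic vectors.\<close>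

lemma plain_iso_iso:
  "real (plain 1 1 b) = (if b = 0 then real q ^ 3 + real q ^ 2 - real q
     else if ip b b = 0 then 2 * real q ^ 2 - real q else real q ^ 2 + real q)"
proof (cases "b = 0")
  case True
  then show ?thesis by (simp add: plain_def real_card_isotropic)
next
  case False
  have "plain 1 1 b = (\<Sum>s\<in>skew. twisted 1 1 b s)"
    unfolding plain_def twisted_def
    by (subst card_eq_sum_fibres[of _ skew "\<lambda>a. sk (ip a b)"]) auto
  also have "\<dots> = (\<Sum>s\<in>skew. if ip b b = 0 then (if s = 0 then q ^ 2 else q) else q + 1)"
    using twisted_iso_iso[OF _ False] by simp
  also have "\<dots> = (if ip b b = 0 then q ^ 2 + (q - 1) * q else q * (q + 1))"
  proof -
    have "0 \<in> skew" by (simp add: skew_def)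
    then have "(\<Sum>s\<in>skew. if s = 0 then q ^ 2 else q) = q ^ 2 + (\<Sum>s\<in>skew - {0}. q)"
      by (subst sum.remove[of _ 0]) auto
    with \<open>0 \<in> skew\<close> show ?thesis by (simp add: card_skew card_Diff_singleton)
  qed
  finally have "plain 1 1 b = (if ip b b = 0 then q ^ 2 + (q - 1) * q else q * (q + 1))" .
  then have "real (plain 1 1 b) =
      (if ip b b = 0 then real (q ^ 2 + (q - 1) * q) else real (q * (q + 1)))"
    by (simp only: split: if_split) simp
  then show ?thesis using False unfolding real_q_identities
    by (simp add: power2_eq_square algebra_simps)
qed

lemma plain_any: "real (plain 1 2 b) = real q ^ 3 + real q ^ 2 - real q"
  "real (plain 2 2 b) = real q ^ 4"
  using card_prod_K by (simp_all add: plain_def real_card_isotropic)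

lemma twisted_table:
  assumes "s \<in> skew" "k \<le> l" "l \<le> 2"
  shows "real (twisted k l b s) = twisted_table (real q) ! k ! l ! cls b s"
proof -
  have "(k = 0 \<and> (l = 0 \<or> l = 1 \<or> l = 2)) \<or> (k = 1 \<and> (l = 1 \<or> l = 2)) \<or> (k = 2 \<and> l = 2)"
    using assms(2,3) by arith
  then show ?thesis
  proof (elim disjE conjE)
    assume "k = 1" "l = 1"
    then show ?thesis
      using twisted_iso_iso[OF assms(1), of b] plain_iso_iso[of 0]
      by (auto simp: twisted_table_def cls_def twisted_at_0)
  next
    assume "k = 1" "l = 2"
    then show ?thesis
      using twisted_iso_any[OF assms(1), of b] plain_any[of 0]
      by (auto simp: twisted_table_def cls_def twisted_at_0)
  next
    assume "k = 2" "l = 2"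
    then show ?thesis
      using twisted_any_any[OF assms(1), of b] plain_any[of 0]
      by (auto simp: twisted_table_def cls_def twisted_at_0)
  qed (auto simp: twisted_zero twisted_table_def cls_def)
qed

lemma plain_table:
  assumes "k \<le> 2" "l \<le> 2"
  shows "real (plain k l b) = plain_table (real q) ! k ! l ! cls b s"
proof -
  have "k = 0 \<or> k = 1 \<or> k = 2" "l = 0 \<or> l = 1 \<or> l = 2"
    using assms by arith+
  then show ?thesis
    using plain_commute[of 1 0 b] plain_commute[of 2 0 b] plain_commute[of 2 1 b]
      plain_any[of b] plain_iso_iso[of b]
    by (elim disjE) (auto simp: plain_zero plain_table_def cls_def)
qed

section \<open>Pairs of points in coordinates\<close>

definition heis :: "(('a \<times> 'a) \<times> 'a) set" where
  "heis = UNIV \<times> skew"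

text \<open>The skew part of \<open>h(Q,R)\<close>, see \<open>hform_affine\<close> below.\<close>

definition bet :: "('a \<times> 'a) \<times> 'a \<Rightarrow> ('a \<times> 'a) \<times> 'a \<Rightarrow> 'a" where
  "bet x y = snd x - snd y + sk (ip (fst y) (fst x))"

definition cl :: "('a \<times> 'a) \<times> 'a \<Rightarrow> ('a \<times> 'a) \<times> 'a \<Rightarrow> nat" where
  "cl x y = cls (fst y - fst x) (bet x y)"

lemma card_heis: "card heis = q ^ 5"
  by (simp add: heis_def card_prod_K card_cartesian_product card_skew card_K eval_nat_numeral)

lemma finite_heis [simp]: "finite heis"
  by (rule finite)

lemma skew_diff: "s \<in> skew \<Longrightarrow> t \<in> skew \<Longrightarrow> s - t \<in> skew"
  and skew_add: "s \<in> skew \<Longrightarrow> t \<in> skew \<Longrightarrow> s + t \<in> skew"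
  by (auto simp: skew_def)

lemma bet_skew: "x \<in> heis \<Longrightarrow> y \<in> heis \<Longrightarrow> bet x y \<in> skew"
  by (auto simp: bet_def heis_def intro!: skew_add skew_diff)

lemma bet_commute: "bet y x = - bet x y"
  using sk_ip_swap[of "fst x" "fst y"] by (simp add: bet_def)

lemma cls_le: "cls b s \<le> 5"
  by (simp add: cls_def)

lemma cl_commute: "cl x y = cl y x"
proof -
  have "cls (- b) (- s) = cls b s" for b s by (simp add: cls_def)
  from this[of "fst y - fst x" "bet x y"] show ?thesis
    by (simp add: cl_def bet_commute[of x y])
qed

lemma cl_eq_0_iff: "cl x y = 0 \<longleftrightarrow> x = y"
proof -
  have "cl x y = 0 \<longleftrightarrow> fst y = fst x \<and> bet x y = 0"
    by (auto simp: cl_def cls_def split: if_splits)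
  also have "\<dots> \<longleftrightarrow> fst y = fst x \<and> snd x = snd y"
    by (rule conj_cong) (simp_all add: bet_def)
  finally show ?thesis by (auto simp: prod_eq_iff)
qed

text \<open>Equality of first components is an equivalence relation; it will witness
  imprimitivity.\<close>

lemma cl_in_0_2_iff: "cl x y \<in> {0, 2} \<longleftrightarrow> fst x = fst y"
  by (auto simp: cl_def cls_def split: if_splits)

lemma cl_ex:
  assumes "i \<le> 5"
  shows "\<exists>x\<in>heis. \<exists>y\<in>heis. cl x y = i"
proof -
  obtain s where s: "s \<in> skew" "s \<noteq> 0"
    using card_skew q_gt_2 card_mono[of "{0}" skew] by (force simp: subset_iff)
  \<comment> \<open>There are \<open>q ^ 3 + q ^ 2 - q\<close> isotropic vectors, which is more than
    the zero vector alone.\<close>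
  have "\<exists>b. ip b b = 0 \<and> b \<noteq> 0"
  proof (rule ccontr)
    assume "\<not> (\<exists>b. ip b b = 0 \<and> b \<noteq> 0)"
    then have "card {b. ip b b = 0} \<le> card {0 :: 'a \<times> 'a}" by (intro card_mono) auto
    moreover have "q ^ 3 > q" "q ^ 2 > 1"
      using q_gt_2 power_strict_increasing[of 1 3 q] one_less_power[of q 2] by auto
    ultimately show False using card_isotropic by simp
  qed
  then obtain b where b: "ip b b = 0" "b \<noteq> 0" by blast
  have u: "ip (1, 0) (1, 0) \<noteq> 0" "(1, 0) \<noteq> (0 :: 'a \<times> 'a)"
    by (simp_all add: ip_def zero_prod_def)
  have 0: "(0, 0) \<in> heis" "(v, 0) \<in> heis" "(v, s) \<in> heis" for v
    using s by (auto simp: heis_def skew_def)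
  have val: "cl (0, 0) (v, t) = cls v (- t)" for v t
    by (simp add: cl_def bet_def)
  have vals: "cl (0, 0) (0, 0) = 0" "cl (0, 0) (b, 0) = 1" "cl (0, 0) (0, s) = 2"
    "cl (0, 0) (b, s) = 3" "cl (0, 0) ((1, 0), s) = 4" "cl (0, 0) ((1, 0), 0) = 5"
    using b u s by (simp_all add: val cls_def)
  show ?thesis
    using le_5_cases[OF assms] vals 0 by (elim disjE) blast+
qed

text \<open>The additivity defect of \<open>bet\<close> along \<open>x, z, y\<close> is the cocycle of the Heisenberg group.\<close>

lemma bet_middle:
  assumes "fst z = fst x + a" "bet x z = 0"
  shows "bet z y = bet x y - sk (ip a (fst y - fst x))"
proof -
  have "snd x = snd z - sk (ip (fst x + a) (fst x))"
    using assms by (simp add: bet_def algebra_simps eq_neg_iff_add_eq_0)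
  then show ?thesis
    using assms(1) sk_ip_swap[of "fst y" a] sk_ip_swap[of "fst x" a]
    by (simp add: bet_def ip_add ip_diff sk_add sk_diff algebra_simps)
qed

text \<open>The condition \<open>bet x z = 0\<close> determines \<open>snd z\<close> from
  \<open>fst z\<close>, so \<open>z\<close> corresponds to \<open>a = fst z - fst x\<close>. By
  \<open>bet_middle\<close> the condition \<open>bet z y = 0\<close> then prescribes the skew part
  of \<open>ip a (fst y - fst x)\<close>.\<close>

lemma card_twisted:
  assumes "x \<in> heis" "y \<in> heis"
  shows "card {z \<in> heis. (type_le k (fst z - fst x) \<and> bet x z = 0) \<and>
      (type_le l (fst y - fst z) \<and> bet z y = 0)} = twisted k l (fst y - fst x) (bet x y)"
proof -
  have "bij_betw (\<lambda>z. fst z - fst x)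
      {z \<in> heis. (type_le k (fst z - fst x) \<and> bet x z = 0) \<and> (type_le l (fst y - fst z) \<and> bet z y = 0)}
      {a. (type_le k a \<and> type_le l ((fst y - fst x) - a)) \<and> sk (ip a (fst y - fst x)) = bet x y}"
  proof (rule bij_betwI[where g = "\<lambda>a. (fst x + a, snd x + sk (ip a (fst x)))"])
    have b0: "bet x (fst x + a, snd x + sk (ip a (fst x))) = 0" for a
      by (simp add: bet_def ip_add sk_add)
    then show "(\<lambda>a. (fst x + a, snd x + sk (ip a (fst x)))) \<in>
        {a. (type_le k a \<and> type_le l ((fst y - fst x) - a)) \<and> sk (ip a (fst y - fst x)) = bet x y} \<rightarrow>
        {z \<in> heis. (type_le k (fst z - fst x) \<and> bet x z = 0) \<and> (type_le l (fst y - fst z) \<and> bet z y = 0)}"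
    proof (intro funcsetI CollectI)
      fix a assume a: "a \<in> {a. (type_le k a \<and> type_le l ((fst y - fst x) - a)) \<and> sk (ip a (fst y - fst x)) = bet x y}"
      have "bet (fst x + a, snd x + sk (ip a (fst x))) y = 0"
        using bet_middle[OF _ b0, of a a y] a by simp
      with a b0 assms(1) show "(fst x + a, snd x + sk (ip a (fst x))) \<in> heis \<and>
          (type_le k (fst (fst x + a, snd x + sk (ip a (fst x))) - fst x) \<and>
            bet x (fst x + a, snd x + sk (ip a (fst x))) = 0) \<and>
          type_le l (fst y - fst (fst x + a, snd x + sk (ip a (fst x)))) \<and>
          bet (fst x + a, snd x + sk (ip a (fst x))) y = 0"
        by (simp add: heis_def mem_Times_iff skew_add diff_diff_eq)
    qed
    show "(\<lambda>z. fst z - fst x) \<in>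
        {z \<in> heis. (type_le k (fst z - fst x) \<and> bet x z = 0) \<and> (type_le l (fst y - fst z) \<and> bet z y = 0)} \<rightarrow>
        {a. (type_le k a \<and> type_le l ((fst y - fst x) - a)) \<and> sk (ip a (fst y - fst x)) = bet x y}"
    proof (intro funcsetI CollectI)
      fix z assume z: "z \<in> {z \<in> heis. (type_le k (fst z - fst x) \<and> bet x z = 0) \<and> (type_le l (fst y - fst z) \<and> bet z y = 0)}"
      then have "bet z y = bet x y - sk (ip (fst z - fst x) (fst y - fst x))"
        by (intro bet_middle) auto
      with z show "(type_le k (fst z - fst x) \<and> type_le l ((fst y - fst x) - (fst z - fst x))) \<and>
          sk (ip (fst z - fst x) (fst y - fst x)) = bet x y" by simp
    qed
  qed (auto simp: bet_def ip_diff sk_diff prod_eq_iff algebra_simps)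
  then show ?thesis unfolding twisted_def by (rule bij_betw_same_card)
qed

lemma card_half_plain:
  assumes "x \<in> heis" "y \<in> heis"
  shows "card {z \<in> heis. (type_le k (fst z - fst x) \<and> bet x z = 0) \<and> type_le l (fst y - fst z)} =
    plain k l (fst y - fst x)"
proof -
  have "bij_betw (\<lambda>z. fst z - fst x)
      {z \<in> heis. (type_le k (fst z - fst x) \<and> bet x z = 0) \<and> type_le l (fst y - fst z)}
      {a. type_le k a \<and> type_le l ((fst y - fst x) - a)}"
  proof (rule bij_betwI[where g = "\<lambda>a. (fst x + a, snd x + sk (ip a (fst x)))"])
    show "(\<lambda>a. (fst x + a, snd x + sk (ip a (fst x)))) \<in>
        {a. type_le k a \<and> type_le l ((fst y - fst x) - a)} \<rightarrow>
        {z \<in> heis. (type_le k (fst z - fst x) \<and> bet x z = 0) \<and> type_le l (fst y - fst z)}"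
      using assms(1)
      by (intro funcsetI CollectI)
         (simp add: heis_def mem_Times_iff skew_add diff_diff_eq bet_def ip_add sk_add)
  qed (auto simp: bet_def ip_diff sk_diff prod_eq_iff algebra_simps)
  then show ?thesis unfolding plain_def by (rule bij_betw_same_card)
qed

text \<open>With no condition on skew parts, \<open>snd z\<close> ranges freely over
  \<open>skew\<close>; hence the factor \<open>q\<close>.\<close>

lemma card_plain:
  "card {z \<in> heis. type_le k (fst z - fst x) \<and> type_le l (fst y - fst z)} =
    q * plain k l (fst y - fst x)"
proof -
  have "bij_betw (\<lambda>z. (fst z - fst x, snd z))
      {z \<in> heis. type_le k (fst z - fst x) \<and> type_le l (fst y - fst z)}
      ({a. type_le k a \<and> type_le l ((fst y - fst x) - a)} \<times> skew)"
    by (rule bij_betwI[where g = "\<lambda>(a, s). (fst x + a, s)"])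
      (auto simp: heis_def algebra_simps)
  from bij_betw_same_card[OF this] show ?thesis
    by (simp add: plain_def card_cartesian_product card_skew)
qed

end

text \<open>Products are easiest in the basis of the Bose-Mesner algebra given by the nested conditions
  \<open>v' - v = 0\<close>, \<open>N(v' - v) = 0\<close>, none, first combined with \<open>\<beta> = 0\<close> (indices \<open>0, 1, 2\<close>), then
  without it (indices \<open>3, 4, 5\<close>).\<close>

definition basis_classes :: "nat list list" where
  "basis_classes = [[0], [0, 1], [0, 1, 5], [0, 2], [0, 1, 2, 3], [0, 1, 2, 3, 4, 5]]"

definition basis :: "nat \<Rightarrow> nat \<Rightarrow> real" where
  "basis a k = of_bool (k \<in> set (basis_classes ! a))"

text \<open>The inverse of the 0/1 matrix of \<open>basis_classes\<close>: row \<open>i\<close>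
  expresses the indicator of class \<open>i\<close> by inclusion-exclusion.\<close>

definition basis_coeff :: "real list list" where
  "basis_coeff =
    [[1, 0, 0, 0, 0, 0], [- 1, 1, 0, 0, 0, 0], [- 1, 0, 0, 1, 0, 0],
     [1, - 1, 0, - 1, 1, 0], [0, 1, - 1, 0, - 1, 1], [0, - 1, 1, 0, 0, 0]]"

text \<open>Row \<open>a\<close> lists the eigenvalues of the basis matrix \<open>a\<close> on the
  six eigenspaces, so rows and columns are exchanged compared with
  \<open>eigenmatrix_P\<close>.\<close>

definition basis_eigenvalues :: "real \<Rightarrow> real list list" where
  "basis_eigenvalues r =
    [[1, 1, 1, 1, 1, 1],
     [r^3 + r^2 - r, r^2 - r, r^2, - r, - r, - r],
     [r^4, 0, r^2, 0, r^2, - (r^2)],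
     [r, r, 0, r, 0, 0],
     [r^4 + r^3 - r^2, r^3 - r^2, 0, - (r^2), 0, 0],
     [r^5, 0, 0, 0, 0, 0]]"

text \<open>Entry at class \<open>c\<close> of the product of the basis matrices
  \<open>a \<le> b\<close>. The branches are: both factors require skew part 0, only the first does,
  neither does.\<close>

definition basis_product :: "real \<Rightarrow> nat \<Rightarrow> nat \<Rightarrow> nat \<Rightarrow> real" where
  "basis_product r a b c =
    (if b < 3 then twisted_table r ! a ! b ! c
     else if a < 3 then plain_table r ! a ! (b - 3) ! c
     else r * plain_table r ! (a - 3) ! (b - 3) ! c)"

section \<open>Polynomial identities between the tables\<close>

lemma basis_indicator:
  "i \<le> 5 \<Longrightarrow> k \<le> 5 \<Longrightarrow> (\<Sum>a\<le>5. basis_coeff ! i ! a * basis a k) = of_bool (k = i)"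
  by (drule le_5_cases, drule le_5_cases, elim disjE)
     (simp_all add: sum_atMost_5 basis_coeff_def basis_def basis_classes_def)

lemma eigenmatrix_P_basis:
  assumes "i \<le> 5" "m \<le> 5"
  shows "eigenmatrix_P r ! m ! i = (\<Sum>a\<le>5. basis_coeff ! i ! a * basis_eigenvalues r ! a ! m)"
  using assms[THEN le_5_cases]
  by (elim disjE)
     (simp_all add: sum_atMost_5 basis_coeff_def basis_eigenvalues_def eigenmatrix_P_def
       eval_nat_numeral algebra_simps)

lemma eigenmatrix_PQ:
  assumes "i \<le> 5" "j \<le> 5" "r > 0"
  shows "(\<Sum>k\<le>5. eigenmatrix_P r ! i ! k * eigenmatrix_Q r ! k ! j) = (if i = j then r ^ 5 else 0)"
proof -
  have "r + 1 \<noteq> 0" using assms(3) by simp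
  then show ?thesis
    using assms(1,2)[THEN le_5_cases]
    by (elim disjE)
       (simp_all add: sum_atMost_5 eigenmatrix_P_def eigenmatrix_Q_def,
        simp_all add: divide_simps, simp_all add: eval_nat_numeral algebra_simps)
qed

lemma eigenmatrix_QP:
  assumes "i \<le> 5" "j \<le> 5" "r > 0"
  shows "(\<Sum>k\<le>5. eigenmatrix_Q r ! i ! k * eigenmatrix_P r ! k ! j) = (if i = j then r ^ 5 else 0)"
proof -
  have "r + 1 \<noteq> 0" using assms(3) by simp
  then show ?thesis
    using assms(1,2)[THEN le_5_cases]
    by (elim disjE)
       (simp_all add: sum_atMost_5 eigenmatrix_P_def eigenmatrix_Q_def,
        simp_all add: divide_simps, simp_all add: eval_nat_numeral algebra_simps)
qed

text \<open>The eigenvalues multiply as the tables prescribe. Each case is a polynomial identity in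
  \<open>r\<close> once the denominators \<open>r + 1\<close> are cleared.\<close>

lemma basis_product_eigenvalues:
  assumes "a \<le> b" "b \<le> 5" "k \<le> 5" "r > 0"
  shows "r ^ 5 * basis_product r a b k =
    (\<Sum>m\<le>5. basis_eigenvalues r ! a ! m * basis_eigenvalues r ! b ! m * eigenmatrix_Q r ! k ! m)"
proof -
  have "r + 1 \<noteq> 0" using assms(4) by simp
  moreover have "a \<le> 5" using assms(1,2) by simp
  ultimately show ?thesis
    using assms(2,3)[THEN le_5_cases] le_5_cases[OF \<open>a \<le> 5\<close>] assms(1)
    by (elim disjE)
       (simp_all add: sum_atMost_5 basis_eigenvalues_def eigenmatrix_Q_def basis_product_def
         twisted_table_def plain_table_def,
        simp_all add: divide_simps, simp_all add: eval_nat_numeral algebra_simps)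
qed

context hermitian_field
begin

section \<open>Intersection numbers\<close>

lemma basis_cl:
  assumes "a \<le> 5"
  shows "basis a (cl x y) = of_bool (if a < 3 then type_le a (fst y - fst x) \<and> bet x y = 0
    else type_le (a - 3) (fst y - fst x))"
proof -
  have "cls d s \<in> set (basis_classes ! a) \<longleftrightarrow>
      (if a < 3 then type_le a d \<and> s = 0 else type_le (a - 3) d)" for d s
  proof -
    have "d = 0 \<Longrightarrow> ip d d = 0" by simp
    then show ?thesis
      using le_5_cases[OF assms] unfolding cls_def type_le_def
      by (elim disjE; cases "d = 0"; cases "s = 0"; cases "ip d d = 0"; hypsubst_thin)
         (simp_all only: basis_classes_def, simp_all)
  qed
  from this[of "fst y - fst x" "bet x y"] show ?thesis by (simp only: cl_def basis_def)
qed

lemma sum_of_bool_product: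
  "finite A \<Longrightarrow> (\<Sum>z\<in>A. of_bool (F z) * of_bool (G z)) = real (card {z \<in> A. F z \<and> G z})"
  by (simp add: of_bool_conj[symmetric] Int_def)

lemma basis_convolution:
  assumes "x \<in> heis" "y \<in> heis" "a \<le> b" "b \<le> 5"
  shows "(\<Sum>z\<in>heis. basis a (cl x z) * basis b (cl z y)) = basis_product (real q) a b (cl x y)"
proof -
  have s: "bet x y \<in> skew" using assms by (simp add: bet_skew)
  have a: "a \<le> 5" using assms by simp
  have conv: "(\<Sum>z\<in>heis. basis a (cl x z) * basis b (cl z y)) = real (card {z \<in> heis.
      (if a < 3 then type_le a (fst z - fst x) \<and> bet x z = 0 else type_le (a - 3) (fst z - fst x)) \<and>
      (if b < 3 then type_le b (fst y - fst z) \<and> bet z y = 0 else type_le (b - 3) (fst y - fst z))})"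
    by (simp only: basis_cl[OF a] basis_cl[OF assms(4)] sum_of_bool_product finite_heis)
  consider "b < 3" "a < 3" | "a < 3" "\<not> b < 3" | "\<not> a < 3" "\<not> b < 3" using assms(3) by linarith
  then show ?thesis
  proof cases
    case 1
    then show ?thesis
      using assms(3) twisted_table[OF s, of a b] card_twisted[OF assms(1,2), of a b]
      unfolding conv by (simp add: basis_product_def cl_def)
  next
    case 2
    then show ?thesis
      using assms(4) plain_table[of a "b - 3" "fst y - fst x" "bet x y"]
        card_half_plain[OF assms(1,2), of a "b - 3"]
      unfolding conv by (simp add: basis_product_def cl_def)
  next
    case 3
    then show ?thesis
      using a assms(4) plain_table[of "a - 3" "b - 3" "fst y - fst x" "bet x y"]
        card_plain[of "a - 3" x "b - 3" y]
      unfolding conv by (simp add: basis_product_def cl_def)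
  qed
qed

text \<open>Symmetry of \<open>cl\<close> exchanges the two factors, which reduces the claim to the
  tabulated case \<open>a \<le> b\<close>.\<close>

lemma basis_convolution_eigenvalues:
  assumes "x \<in> heis" "y \<in> heis" "a \<le> 5" "b \<le> 5"
  shows "real q ^ 5 * (\<Sum>z\<in>heis. basis a (cl x z) * basis b (cl z y)) =
    (\<Sum>m\<le>5. basis_eigenvalues (real q) ! a ! m * basis_eigenvalues (real q) ! b ! m *
      eigenmatrix_Q (real q) ! cl x y ! m)"
proof -
  have *: "real q ^ 5 * (\<Sum>z\<in>heis. basis a (cl x z) * basis b (cl z y)) =
    (\<Sum>m\<le>5. basis_eigenvalues (real q) ! a ! m * basis_eigenvalues (real q) ! b ! m *
      eigenmatrix_Q (real q) ! cl x y ! m)"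
    if "x \<in> heis" "y \<in> heis" "a \<le> b" "b \<le> 5" for x y a b
    using that q_gt_2 cls_le[of "fst y - fst x" "bet x y"]
    by (simp only: basis_convolution) (rule basis_product_eigenvalues, auto simp: cl_def)
  show ?thesis
  proof (cases "a \<le> b")
    case False
    have "(\<Sum>z\<in>heis. basis a (cl x z) * basis b (cl z y)) =
        (\<Sum>z\<in>heis. basis b (cl y z) * basis a (cl z x))"
      by (simp add: mult.commute cl_commute)
    with *[OF assms(2,1), of b a] False assms(3) show ?thesis
      by (simp add: cl_commute[of y x] mult_ac)
  qed (use * assms in blast)
qed

text \<open>Both class indicators are expanded in the nested basis. There products are known through
  eigenvalues, and collecting the coefficients turns these back into entries of
  \<open>eigenmatrix_P\<close>.\<close>

lemma count_heis:
  assumes "x \<in> heis" "y \<in> heis" "i \<le> 5" "j \<le> 5"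
  shows "real q ^ 5 * real (card {z \<in> heis. cl x z = i \<and> cl z y = j}) =
    (\<Sum>m\<le>5. eigenmatrix_P (real q) ! m ! i * eigenmatrix_P (real q) ! m ! j *
      eigenmatrix_Q (real q) ! cl x y ! m)"
proof -
  let ?c = "\<lambda>i a. basis_coeff ! i ! a" and ?H = "\<lambda>a m. basis_eigenvalues (real q) ! a ! m"
    and ?Q = "\<lambda>m. eigenmatrix_Q (real q) ! cl x y ! m"
  have cl5: "cl x y \<le> 5" for x y by (simp add: cl_def cls_le)
  have "real (card {z \<in> heis. cl x z = i \<and> cl z y = j}) =
      (\<Sum>z\<in>heis. of_bool (cl x z = i) * of_bool (cl z y = j))"
    by (simp only: sum_of_bool_product finite_heis)
  also have "\<dots> = (\<Sum>z\<in>heis. (\<Sum>a\<le>5. ?c i a * basis a (cl x z)) * (\<Sum>b\<le>5. ?c j b * basis b (cl z y)))"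
    by (simp only: basis_indicator[OF assms(3) cl5] basis_indicator[OF assms(4) cl5])
  also have "\<dots> = (\<Sum>z\<in>heis. \<Sum>a\<le>5. \<Sum>b\<le>5. ?c i a * ?c j b * (basis a (cl x z) * basis b (cl z y)))"
    by (simp only: sum_product mult_ac)
  also have "\<dots> = (\<Sum>a\<le>5. \<Sum>b\<le>5. \<Sum>z\<in>heis. ?c i a * ?c j b * (basis a (cl x z) * basis b (cl z y)))"
    by (subst sum.swap, intro sum.cong refl, rule sum.swap)
  finally have "real q ^ 5 * real (card {z \<in> heis. cl x z = i \<and> cl z y = j}) =
      (\<Sum>a\<le>5. \<Sum>b\<le>5. ?c i a * ?c j b * (real q ^ 5 * (\<Sum>z\<in>heis. basis a (cl x z) * basis b (cl z y))))"
    by (simp only: sum_distrib_left mult_ac)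
  also have "\<dots> = (\<Sum>a\<le>5. \<Sum>b\<le>5. ?c i a * ?c j b * (\<Sum>m\<le>5. ?H a m * ?H b m * ?Q m))"
    by (intro sum.cong refl) (simp only: basis_convolution_eigenvalues[OF assms(1,2)] atMost_iff)
  also have "\<dots> = (\<Sum>a\<le>5. \<Sum>b\<le>5. \<Sum>m\<le>5. ?c i a * ?c j b * (?H a m * ?H b m * ?Q m))"
    by (simp only: sum_distrib_left)
  also have "\<dots> = (\<Sum>m\<le>5. \<Sum>a\<le>5. \<Sum>b\<le>5. ?c i a * ?c j b * (?H a m * ?H b m * ?Q m))"
    by (subst (2) sum.swap, subst sum.swap) (rule refl)
  also have "\<dots> = (\<Sum>m\<le>5. (\<Sum>a\<le>5. ?c i a * ?H a m) * (\<Sum>b\<le>5. ?c j b * ?H b m) * ?Q m)"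
    by (intro sum.cong refl, subst sum.swap) (simp add: sum_distrib_left sum_distrib_right mult_ac)
  also have "\<dots> = (\<Sum>m\<le>5. eigenmatrix_P (real q) ! m ! i * eigenmatrix_P (real q) ! m ! j * ?Q m)"
    by (intro sum.cong refl) (simp add: eigenmatrix_P_basis assms(3,4))
  finally show ?thesis .
qed

section \<open>Coordinates on the Hermitian surface\<close>

definition mk :: "'a \<Rightarrow> 'a \<Rightarrow> 'a \<Rightarrow> 'a \<Rightarrow> 'a ^ 4" where
  "mk a b c d = (\<chi> i. if i = 0 then a else if i = 1 then b else if i = 2 then c else d)"

lemma mk_nth [simp]: "mk a b c d $ 0 = a" "mk a b c d $ 1 = b" "mk a b c d $ 2 = c" "mk a b c d $ 3 = d"
  by (simp_all add: mk_def)

lemma vec4_eq_iff: "x = y \<longleftrightarrow> x $ 0 = y $ 0 \<and> x $ 1 = y $ 1 \<and> x $ 2 = y $ 2 \<and> x $ 3 = y $ 3"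
  for x y :: "'a ^ 4"
proof -
  \<comment> \<open>\<open>forall_4\<close> enumerates the indices as 1, 2, 3, 4, and 4 is the index
    0 of the coordinates used here.\<close>
  have "(4::4) = 0" by simp
  then have "x $ 4 = x $ 0" "y $ 4 = y $ 0" by (metis (full_types))+
  then show ?thesis by (auto simp: vec_eq_iff forall_4)
qed

lemma hform_cj: "hform q x y = x $ 0 * cj (y $ 3) - x $ 1 * cj (y $ 1) - x $ 2 * cj (y $ 2) + x $ 3 * cj (y $ 0)"
  by (simp add: hform_def cj_def)

section \<open>Transitivity of isometries on the surface\<close>

definition isometry :: "('a ^ 4 \<Rightarrow> 'a ^ 4) \<Rightarrow> bool" where
  "isometry g \<longleftrightarrow> (\<forall>x y. g (x + y) = g x + g y) \<and> (\<forall>c x. g (c *s x) = c *s g x) \<and>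
     (\<forall>x y. hform q (g x) (g y) = hform q x y)"

lemma isometry_comp: "isometry f \<Longrightarrow> isometry g \<Longrightarrow> isometry (\<lambda>x. f (g x))"
  by (simp add: isometry_def)

text \<open>Injectivity comes from the nondegeneracy of the form, tested on the unit vectors;
  finiteness does the rest.\<close>

lemma isometry_bij:
  assumes "isometry g"
  shows "bij g"
proof -
  have "inj g"
  proof (rule injI)
    fix x y assume "g x = g y"
    then have eq: "hform q x z = hform q y z" for z
      using assms unfolding isometry_def by metis
    show "x = y"
      using eq[of "mk 1 0 0 0"] eq[of "mk 0 1 0 0"] eq[of "mk 0 0 1 0"] eq[of "mk 0 0 0 1"]
      by (simp add: hform_cj vec4_eq_iff)
  qed
  then show ?thesis by (simp add: bij_def finite_UNIV_inj_surj)
qed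

definition swap :: "'a ^ 4 \<Rightarrow> 'a ^ 4" where
  "swap x = mk (x $ 3) (x $ 1) (x $ 2) (x $ 0)"

text \<open>The unipotent map fixing \<open>mk 1 0 0 0\<close> and sending \<open>mk 0 0 0 1\<close>
  to \<open>mk a b c 1\<close>. It is an isometry when the image vector is isotropic.\<close>

definition translation :: "'a \<Rightarrow> 'a \<Rightarrow> 'a \<Rightarrow> 'a ^ 4 \<Rightarrow> 'a ^ 4" where
  "translation a b c x = mk (x $ 0 + cj b * x $ 1 + cj c * x $ 2 + a * x $ 3)
     (x $ 1 + b * x $ 3) (x $ 2 + c * x $ 3) (x $ 3)"

lemma isometry_swap: "isometry swap"
  by (simp add: isometry_def swap_def hform_cj vec4_eq_iff)

lemma isometry_translation:
  assumes "a + cj a = b * cj b + c * cj c"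
  shows "isometry (translation a b c)"
proof -
  have "hform q (translation a b c x) (translation a b c y) = hform q x y
      + (a + cj a - (b * cj b + c * cj c)) * (x $ 3 * cj (y $ 3))" for x y
    by (simp add: hform_cj translation_def algebra_simps)
  then show ?thesis
    unfolding isometry_def using assms
    by (simp add: translation_def vec4_eq_iff algebra_simps)
qed

lemma isometry_to_point_3:
  assumes "p $ 3 \<noteq> 0" "hform q p p = 0"
  shows "\<exists>g k. isometry g \<and> k \<noteq> 0 \<and> g (mk 1 0 0 0) = k *s p"
proof -
  define a b c where abc: "a = p $ 0 / p $ 3" "b = p $ 1 / p $ 3" "c = p $ 2 / p $ 3"
  have p: "p $ 0 = a * p $ 3" "p $ 1 = b * p $ 3" "p $ 2 = c * p $ 3"
    using assms(1) by (simp_all add: abc)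
  have "p $ 3 * cj (p $ 3) * (a + cj a - (b * cj b + c * cj c)) = 0"
    using assms(2) unfolding hform_cj p by (simp add: algebra_simps)
  then have "isometry (translation a b c)"
    using assms(1) by (intro isometry_translation) simp
  then have "isometry (\<lambda>x. translation a b c (swap x))" by (rule isometry_comp[OF _ isometry_swap])
  moreover have "translation a b c (swap (mk 1 0 0 0)) = (1 / p $ 3) *s p"
    using assms(1) by (simp add: translation_def swap_def vec4_eq_iff abc)
  ultimately show ?thesis
    using assms(1) by (intro exI[of _ "\<lambda>x. translation a b c (swap x)"] exI[of _ "1 / p $ 3"]) simp
qed

lemma isometry_to_point_0:
  assumes "p $ 0 \<noteq> 0" "hform q p p = 0"
  shows "\<exists>g k. isometry g \<and> k \<noteq> 0 \<and> g (mk 1 0 0 0) = k *s p"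
proof -
  have "hform q (swap p) (swap p) = 0" using assms(2) isometry_swap by (simp add: isometry_def)
  moreover have "swap p $ 3 \<noteq> 0" using assms(1) by (simp add: swap_def)
  ultimately obtain g k where g: "isometry g" "k \<noteq> 0" "g (mk 1 0 0 0) = k *s swap p"
    using isometry_to_point_3 by blast
  have "swap (g (mk 1 0 0 0)) = k *s p" by (simp add: g(3) swap_def vec4_eq_iff)
  with g show ?thesis
    by (intro exI[of _ "\<lambda>x. swap (g x)"] exI[of _ k]) (simp add: isometry_comp isometry_swap)
qed

text \<open>A point whose outer coordinates both vanish is first moved by a translation to one with
  nonzero coordinate 0, and the inverse translation brings it back.\<close>

lemma isometry_to_point:
  assumes "p \<noteq> 0" "hform q p p = 0"
  shows "\<exists>g k. isometry g \<and> k \<noteq> 0 \<and> g (mk 1 0 0 0) = k *s p"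
proof (cases "p $ 3 = 0 \<and> p $ 0 = 0")
  case True
  have half: "1 / 2 + cj (1 / 2) = (1::'a)" by (simp flip: add_divide_distrib)
  have "- (p $ 1 * cj (p $ 1)) - p $ 2 * cj (p $ 2) = 0"
    using assms(2) True by (simp add: hform_cj)
  moreover have "p $ 1 \<noteq> 0 \<or> p $ 2 \<noteq> 0"
    using assms(1) True by (simp add: vec4_eq_iff)
  ultimately have p1: "p $ 1 \<noteq> 0" by auto
  \<comment> \<open>The first map adds \<open>p $ 1\<close> to coordinate 0, and
    \<open>1 / 2\<close> is an element of trace 1, the norm of 1 and of \<open>- 1\<close>. The
    second map inverts the first.\<close>
  let ?t = "translation (1 / 2) 1 0" and ?t' = "translation (1 / 2) (- 1) 0"
  have t: "isometry ?t" "isometry ?t'" using half by (auto intro!: isometry_translation)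
  have "?t p $ 0 \<noteq> 0" using True p1 by (simp add: translation_def)
  moreover have "hform q (?t p) (?t p) = 0" using t(1) assms(2) by (simp add: isometry_def)
  ultimately obtain g k where g: "isometry g" "k \<noteq> 0" "g (mk 1 0 0 0) = k *s ?t p"
    using isometry_to_point_0 by blast
  have "?t' (g (mk 1 0 0 0)) = k *s p"
    using True by (simp add: g(3) translation_def vec4_eq_iff algebra_simps)
  with g t show ?thesis
    by (intro exI[of _ "\<lambda>x. ?t' (g x)"] exI[of _ k]) (simp add: isometry_comp)
qed (use assms isometry_to_point_3 isometry_to_point_0 in blast)

section \<open>The quotient group \<open>T\<close> and its cosets\<close>

lemma GFq_star_eq: "GFq_star q = fixed - {0}"
  by (simp add: GFq_star_def fixed_def cj_def)

definition coset :: "'a \<Rightarrow> 'a set" where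
  "coset x = {k * x | k. k \<in> GFq_star q}"

lemma self_in_coset: "x \<in> coset x"
  by (force simp: coset_def GFq_star_eq fixed_def)

lemma coset_fixed:
  assumes "x \<in> fixed" "x \<noteq> 0"
  shows "coset x = GFq_star q"
proof (intro equalityI subsetI)
  fix y :: 'a assume "y \<in> GFq_star q"
  then have "y = (y / x) * x" "y / x \<in> GFq_star q" using assms by (auto simp: GFq_star_eq fixed_def)
  then show "y \<in> coset x" unfolding coset_def by blast
qed (use assms in \<open>auto simp: coset_def GFq_star_eq fixed_def\<close>)

lemma coset_skew:
  assumes "x \<in> skew" "x \<noteq> 0"
  shows "coset x = skew - {0}"
proof (intro equalityI subsetI)
  fix y assume "y \<in> skew - {0}"
  then have "y = (y / x) * x" "y / x \<in> GFq_star q"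
    using assms by (auto simp: GFq_star_eq fixed_def skew_def)
  then show "y \<in> coset x" unfolding coset_def by blast
qed (use assms in \<open>auto simp: coset_def GFq_star_eq fixed_def skew_def\<close>)

lemma coset_eq_0_iff: "coset x = {0} \<longleftrightarrow> x = 0"
proof
  assume "x = 0"
  then have "coset x \<subseteq> {0}" by (auto simp: coset_def)
  then show "coset x = {0}" using self_in_coset[of x] by auto
qed (use self_in_coset[of x] in auto)

lemma coset_eq_fixed_iff: "coset x = GFq_star q \<longleftrightarrow> x \<in> fixed \<and> x \<noteq> 0"
  using self_in_coset[of x] coset_fixed[of x] by (auto simp: GFq_star_eq)

lemma coset_eq_skew_iff: "coset x = skew - {0} \<longleftrightarrow> x \<in> skew \<and> x \<noteq> 0"
  using self_in_coset[of x] coset_skew[of x] by auto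

lemma r_coset_eq: "GFq_star q #>\<^bsub>mult_group\<^esub> x = coset x"
  by (auto simp: r_coset_def mult_group_def coset_def)

lemma carrier_T: "carrier (T_group q) = coset ` (UNIV - {0})"
  by (auto simp: T_group_def FactGroup_def RCOSETS_def r_coset_eq) (auto simp: mult_group_def)

lemma one_T: "\<one>\<^bsub>T_group q\<^esub> = (GFq_star q :: 'a set)"
  by (simp add: T_group_def FactGroup_def)

lemma mult_T: "coset x \<otimes>\<^bsub>T_group q\<^esub> coset y = coset (x * y)"
proof -
  have "coset x \<otimes>\<^bsub>T_group q\<^esub> coset y = {a * b | a b. a \<in> coset x \<and> b \<in> coset y}"
    by (auto simp: T_group_def FactGroup_def set_mult_def mult_group_def)
  also have "\<dots> = coset (x * y)"
  proof (intro equalityI subsetI)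
    fix z assume "z \<in> {a * b | a b. a \<in> coset x \<and> b \<in> coset y}"
    then obtain k l where kl: "z = (k * x) * (l * y)" "k \<in> GFq_star q" "l \<in> GFq_star q"
      unfolding coset_def by blast
    then have "z = (k * l) * (x * y)" by (simp add: mult_ac)
    moreover from kl have "k * l \<in> GFq_star q" by (simp add: GFq_star_eq fixed_def)
    ultimately show "z \<in> coset (x * y)" unfolding coset_def by blast
  next
    fix z assume "z \<in> coset (x * y)"
    then obtain k where "z = (k * x) * y" "k \<in> GFq_star q" by (auto simp: coset_def mult_ac)
    moreover from this have "k * x \<in> coset x" by (auto simp: coset_def)
    ultimately show "z \<in> {a * b | a b. a \<in> coset x \<and> b \<in> coset y}"
      using self_in_coset by blast
  qed
  finally show ?thesis .
qed

text \<open>The nonzero skew elements form one coset, whose square is the identity because the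
  product of two skew elements is fixed.\<close>

lemma T_involution_eq: "T_involution q = skew - {0}"
  unfolding T_involution_def
proof (rule the_equality)
  have "card (skew - {0}) > 0" using card_skew q_gt_2 by (simp add: card_Diff_singleton skew_def)
  then obtain x where x: "x \<in> skew" "x \<noteq> 0" by (auto simp: card_gt_0_iff)
  then have c: "skew - {0} = coset x" by (simp add: coset_skew)
  have "x * x \<in> fixed" "x \<notin> fixed" using x fixed_skew_0 by (auto simp: fixed_def skew_def)
  then show "skew - {0} \<in> carrier (T_group q) \<and> skew - {0} \<noteq> \<one>\<^bsub>T_group q\<^esub> \<and>
    (skew - {0}) \<otimes>\<^bsub>T_group q\<^esub> (skew - {0}) = \<one>\<^bsub>T_group q\<^esub>"
    using x unfolding c by (auto simp: carrier_T one_T mult_T coset_eq_fixed_iff)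
next
  fix t :: "'a set" assume t: "t \<in> carrier (T_group q) \<and> t \<noteq> \<one>\<^bsub>T_group q\<^esub> \<and>
    t \<otimes>\<^bsub>T_group q\<^esub> t = \<one>\<^bsub>T_group q\<^esub>"
  then obtain x where x: "t = coset x" "x \<noteq> 0" by (auto simp: carrier_T)
  with t have "x \<notin> fixed" "x * x \<in> fixed"
    by (auto simp: one_T mult_T coset_eq_fixed_iff)
  \<comment> \<open>A fixed square means that \<open>cj x\<close> is \<open>x\<close> or
    \<open>- x\<close>, and the first is excluded.\<close>
  then have "(cj x - x) * (cj x + x) = 0" "cj x - x \<noteq> 0"
    by (auto simp: fixed_def algebra_simps)
  then have "x \<in> skew" by (simp add: skew_def eq_neg_iff_add_eq_0)
  with x show "t = skew - {0}" by (simp add: coset_skew)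
qed

lemma coset_in_Gamma_iff: "coset x \<in> T_Gamma q \<longleftrightarrow> x \<notin> fixed \<and> x \<notin> skew"
proof (cases "x = 0")
  case True
  have "coset x \<noteq> coset y" if "y \<noteq> 0" for y
    using that True coset_eq_0_iff[of x] coset_eq_0_iff[of y] by simp
  then show ?thesis using True by (auto simp: T_Gamma_def carrier_T fixed_def)
next
  case False
  then show ?thesis
    by (auto simp: T_Gamma_def carrier_T one_T T_involution_eq coset_eq_fixed_iff coset_eq_skew_iff)
qed

section \<open>Points and relations in coordinates\<close>

definition affine :: "('a \<times> 'a) \<times> 'a \<Rightarrow> 'a ^ 4" where
  "affine x = mk (ip (fst x) (fst x) / 2 + snd x) (fst (fst x)) (snd (fst x)) 1"

text \<open>Splits the form value into its fixed part, half the norm of the difference, and its skew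
  part; this is what relates \<open>z_triple\<close> to \<open>cls\<close>.\<close>

lemma hform_affine:
  assumes "y \<in> heis"
  shows "hform q (affine x) (affine y) = ip (fst y - fst x) (fst y - fst x) / 2 + bet x y"
proof -
  have s: "cj (snd y) = - snd y" using assms by (auto simp: heis_def skew_def)
  let ?v = "fst x" and ?w = "fst y"
  have "hform q (affine x) (affine y) = ip ?v ?v / 2 + ip ?w ?w / 2 + snd x - snd y - ip ?v ?w"
    by (simp add: hform_cj affine_def s) (simp add: ip_def)
  moreover have "ip (?w - ?v) (?w - ?v) / 2 + sk (ip ?w ?v) =
      ip ?v ?v / 2 + ip ?w ?w / 2 - (2 * ip ?v ?w) / 2"
    by (simp only: ip_diff sk_def cj_ip add_divide_distrib[symmetric] diff_divide_distrib[symmetric])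
      (simp add: algebra_simps)
  ultimately show ?thesis by (simp add: bet_def)
qed

lemma affine_nonzero: "affine x \<noteq> 0"
  by (simp add: affine_def vec4_eq_iff)

end

lemma span_scale_single:
  fixes x :: "'a::field ^ 'n"
  assumes "c \<noteq> 0"
  shows "vec.span {c *s x} = vec.span {x}"
proof -
  have "c *s x \<in> vec.span {x}" by (intro vec.span_scale vec.span_base) simp
  moreover have "(1 / c) *s (c *s x) \<in> vec.span {c *s x}"
    by (intro vec.span_scale vec.span_base) simp
  then have "x \<in> vec.span {c *s x}" using assms by simp
  ultimately show ?thesis by (simp add: vec.span_eq)
qed

locale hermitian_frame = hermitian_field q "TYPE('a::{field,finite})"
  for q :: nat +
  fixes P :: "('a::{field,finite} ^ 4) set" and g :: "'a ^ 4 \<Rightarrow> 'a ^ 4"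
  assumes isometry: "isometry g" and P: "P = vec.span {g (mk 1 0 0 0)}"
begin

definition point :: "('a \<times> 'a) \<times> 'a \<Rightarrow> ('a ^ 4) set" where
  "point x = vec.span {g (affine x)}"

lemma g_scale: "g (c *s x) = c *s g x" and g_add: "g (x + y) = g x + g y"
  and hform_g [simp]: "hform q (g x) (g y) = hform q x y"
  using isometry by (auto simp: isometry_def)

lemma g_eq_iff: "g x = g y \<longleftrightarrow> x = y"
  using isometry_bij[OF isometry] by (auto simp: bij_def inj_def)

lemma g_0 [simp]: "g 0 = 0"
  using g_scale[of 0 0] by simp

lemma g_eq_0_iff [simp]: "g x = 0 \<longleftrightarrow> x = 0"
  using g_eq_iff[of x 0] by simp

lemma e0_nonzero [simp]: "mk 1 0 0 0 \<noteq> 0"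
  by (simp add: vec4_eq_iff)

lemma hform_e0_affine [simp]: "hform q (mk 1 0 0 0) (affine x) = 1" "hform q (affine x) (mk 1 0 0 0) = 1"
  by (simp_all add: hform_cj affine_def)

lemma point_inj:
  assumes "point x = point y"
  shows "x = y"
proof -
  obtain c where "c \<noteq> 0" "g (affine x) = c *s g (affine y)"
    using span_single_eq_imp_scale[of "g (affine x)" "g (affine y)"] assms affine_nonzero
    by (auto simp: point_def)
  then have eq: "affine x = c *s affine y" by (simp add: g_scale[symmetric] g_eq_iff)
  from arg_cong[OF this, of "\<lambda>v. v $ 3"] have "c = 1" by (simp add: affine_def)
  with eq have "fst x = fst y" by (simp add: affine_def vec4_eq_iff prod_eq_iff)
  with eq \<open>c = 1\<close> show ?thesis by (simp add: affine_def vec4_eq_iff prod_eq_iff)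
qed

lemma point_eq_iff: "point x = point y \<longleftrightarrow> x = y"
  using point_inj by blast

lemma point_in:
  assumes "x \<in> heis"
  shows "point x \<in> noncollinear_points q P"
proof -
  have "hform q (affine x) (affine x) = 0"
    using hform_affine[OF assms, of x] by (simp add: bet_def)
  then have "point x \<in> hermitian_surface q"
    unfolding hermitian_surface_def point_def using affine_nonzero[of x]
    by (auto intro!: exI[of _ "g (affine x)"])
  moreover have "\<not> collinear_on_surface q P (point x)"
    unfolding P point_def by (subst collinear_on_surface_span) (auto simp: affine_nonzero)
  ultimately show ?thesis by (simp add: noncollinear_points_def)
qed

text \<open>Noncollinearity with \<open>P\<close> makes the last coordinate nonzero, so it can be
  scaled to 1. Isotropy then gives coordinate 0 the trace \<open>ip v v\<close>, where
  \<open>v\<close> consists of the middle coordinates, and leaves only its skew part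
  \<open>s\<close> free.\<close>

lemma point_surj:
  assumes "Q \<in> noncollinear_points q P"
  shows "Q \<in> point ` heis"
proof -
  obtain x where x: "Q = vec.span {x}" "x \<noteq> 0" "hform q x x = 0"
    using assms by (auto simp: noncollinear_points_def hermitian_surface_def)
  obtain y where y: "x = g y" using isometry_bij[OF isometry] by (metis bij_pointE)
  have "hform q (mk 1 0 0 0) y \<noteq> 0"
    using assms x(1,2) collinear_on_surface_span[of "g (mk 1 0 0 0)" "g y" q]
    by (auto simp: noncollinear_points_def P y)
  then have y3: "y $ 3 \<noteq> 0" by (simp add: hform_cj)
  define z where "z = (1 / y $ 3) *s y"
  have yz: "y = y $ 3 *s z" using y3 by (simp add: z_def vec_eq_iff)
  have z3: "z $ 3 = 1" using y3 by (simp add: z_def)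
  have "hform q y y = 0" using x(3) y by simp
  then have "hform q z z = 0" by (simp add: z_def hform_scale)
  then have zz: "z $ 0 + cj (z $ 0) = ip (z $ 1, z $ 2) (z $ 1, z $ 2)"
    by (simp add: hform_cj z3 ip_def algebra_simps)
  define s where "s = z $ 0 - ip (z $ 1, z $ 2) (z $ 1, z $ 2) / 2"
  have s: "s \<in> skew"
  proof -
    let ?n = "ip (z $ 1, z $ 2) (z $ 1, z $ 2)"
    have "cj s + s = (z $ 0 + cj (z $ 0)) - (?n / 2 + ?n / 2)" by (simp add: s_def)
    also have "\<dots> = 0" unfolding zz by (simp only: add_divide_distrib[symmetric]) simp
    finally show ?thesis by (simp add: skew_def eq_neg_iff_add_eq_0)
  qed
  have "z = affine ((z $ 1, z $ 2), s)"
    by (simp add: affine_def s_def vec4_eq_iff z3)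
  moreover have "vec.span {g y} = vec.span {g z}"
    by (subst yz) (simp only: g_scale span_scale_single[OF y3])
  ultimately have "Q = point ((z $ 1, z $ 2), s)" using x(1) y by (simp add: point_def)
  moreover have "((z $ 1, z $ 2), s) \<in> heis" using s by (simp add: heis_def)
  ultimately show ?thesis by (rule image_eqI)
qed

lemma point_bij: "bij_betw point heis (noncollinear_points q P)"
  using point_in point_surj by (auto simp: bij_betw_def inj_on_def point_eq_iff)

text \<open>The chosen representatives have form value 1 with that of \<open>P\<close>, so only the
  third factor of the triple product survives.\<close>

lemma z_triple_point:
  assumes "y \<in> heis"
  shows "z_triple q P (point x) (point y) =
    coset (ip (fst y - fst x) (fst y - fst x) / 2 + bet x y)"
  unfolding P point_def
  by (subst z_triple_span) (simp_all add: card_K affine_nonzero hform_affine[OF assms] coset_def)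

lemma affine_in_span:
  assumes "g (affine y) \<in> vec.span {g (mk 1 0 0 0), g (affine x)}"
  shows "fst x = fst y"
proof -
  obtain k where "g (affine y) - k *s g (mk 1 0 0 0) \<in> vec.span {g (affine x)}"
    using assms by (auto simp: vec.span_insert)
  then obtain c where "g (affine y) - k *s g (mk 1 0 0 0) = c *s g (affine x)"
    by (auto simp: vec.span_singleton)
  then have "g (affine y) = g (k *s mk 1 0 0 0 + c *s affine x)"
    by (simp add: g_add g_scale diff_eq_eq add.commute)
  then have "affine y = k *s mk 1 0 0 0 + c *s affine x" by (simp add: g_eq_iff)
  then have "1 = c" "fst (fst y) = c * fst (fst x)" "snd (fst y) = c * snd (fst x)"
    by (simp_all add: affine_def vec4_eq_iff)
  then show ?thesis by (simp add: prod_eq_iff)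
qed

text \<open>The line through \<open>P\<close> and \<open>point x\<close> is the span of two
  independent vectors. On it, a vector with last coordinate 1 has the same middle coordinates as
  \<open>affine x\<close>.\<close>

lemma common_line_point_iff: "on_common_line P (point x) (point y) \<longleftrightarrow> fst x = fst y"
proof -
  let ?B = "{g (mk 1 0 0 0), g (affine x)}"
  have ne: "g (mk 1 0 0 0) \<noteq> g (affine x)" unfolding g_eq_iff by (simp add: affine_def vec4_eq_iff)
  have "g (affine x) \<notin> vec.span {g (mk 1 0 0 0)}"
  proof
    assume "g (affine x) \<in> vec.span {g (mk 1 0 0 0)}"
    then obtain c where "g (affine x) = g (c *s mk 1 0 0 0)"
      by (auto simp: vec.span_singleton g_scale)
    then show False unfolding g_eq_iff by (simp add: affine_def vec4_eq_iff)
  qed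
  then have indep: "vec.independent ?B"
    using ne by (simp add: vec.independent_insert insert_commute[of "g (mk 1 0 0 0)"])
  show ?thesis
  proof
    assume "on_common_line P (point x) (point y)"
    then obtain L where L: "vec.dim L = 2" "P \<subseteq> L" "point x \<subseteq> L" "point y \<subseteq> L"
      by (auto simp: on_common_line_def)
    have "?B \<subseteq> L" "g (affine y) \<in> L"
      using L(2-4) vec.span_superset unfolding P point_def by blast+
    moreover have "L \<subseteq> vec.span ?B"
      by (rule vec.card_ge_dim_independent[OF \<open>?B \<subseteq> L\<close> indep]) (simp add: L(1) ne)
    ultimately show "fst x = fst y" using affine_in_span by blast
  next
    assume eq: "fst x = fst y"
    have "affine y = affine x + (snd y - snd x) *s mk 1 0 0 0"
      using eq by (simp add: affine_def vec4_eq_iff)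
    then have "g (affine y) = g (affine x) + (snd y - snd x) *s g (mk 1 0 0 0)"
      by (simp add: g_add g_scale)
    then have "g (affine y) \<in> vec.span ?B"
      by (simp add: vec.span_add vec.span_scale vec.span_base)
    then have "P \<subseteq> vec.span ?B" "point x \<subseteq> vec.span ?B" "point y \<subseteq> vec.span ?B"
      unfolding P point_def by (simp_all add: vec.span_minimal vec.span_base)
    moreover have "vec.dim (vec.span ?B) = 2"
      using vec.dim_span_eq_card_independent[OF indep] ne by simp
    ultimately show "on_common_line P (point x) (point y)"
      unfolding on_common_line_def using vec.subspace_span by blast
  qed
qed

text \<open>The coset of \<open>n + b\<close>, with \<open>n\<close> fixed and \<open>b\<close>
  skew, is zero if both vanish, the identity if only \<open>b\<close> does, the involution if only
  \<open>n\<close> does, and in \<open>T_Gamma q\<close> otherwise.\<close>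

lemma scheme_rel_point:
  assumes x: "x \<in> heis" and y: "y \<in> heis" and i: "i \<le> 5"
  shows "(point x, point y) \<in> scheme_rel q P i \<longleftrightarrow> cl x y = i"
proof -
  define d where "d = fst y - fst x"
  define n where "n = ip d d / 2"
  define b where "b = bet x y"
  have n: "n \<in> fixed" and b: "b \<in> skew"
    using x y by (simp_all add: n_def fixed_def b_def bet_skew)
  have fixed: "n + b \<in> fixed \<longleftrightarrow> b = 0"
  proof
    assume "n + b \<in> fixed"
    then have "b \<in> fixed" using n by (simp add: fixed_def)
    then show "b = 0" using fixed_skew_0 b by blast
  qed (use n in simp)
  have skew: "n + b \<in> skew \<longleftrightarrow> n = 0"
  proof
    assume "n + b \<in> skew"
    then have "n \<in> skew" using b by (simp add: skew_def)
    then show "n = 0" using fixed_skew_0 n by blast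
  qed (use b in simp)
  have zero: "n + b = 0 \<longleftrightarrow> n = 0 \<and> b = 0"
  proof
    assume "n + b = 0"
    then have "n + b \<in> fixed" "n + b \<in> skew" by (simp_all add: fixed_def skew_def)
    then show "n = 0 \<and> b = 0" using fixed skew by simp
  qed simp
  have z: "z_triple q P (point x) (point y) = coset (n + b)"
    using z_triple_point[OF y, of x] by (simp add: n_def b_def d_def)
  have eq: "x = y \<longleftrightarrow> d = 0 \<and> b = 0"
    using cl_eq_0_iff[of x y] by (auto simp: cl_def cls_def d_def b_def split: if_splits)
  have line: "fst x = fst y \<longleftrightarrow> d = 0" by (auto simp: d_def)
  have n0: "ip d d = 0 \<longleftrightarrow> n = 0" by (simp add: n_def)
  have d0: "d = 0 \<Longrightarrow> n = 0" by (simp add: n_def)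
  have "(point x, point y) \<in> scheme_rel q P i \<longleftrightarrow>
      [d = 0 \<and> b = 0, \<not> (d = 0 \<and> b = 0) \<and> n = 0 \<and> b = 0, \<not> (d = 0 \<and> b = 0) \<and> d = 0,
       \<not> (d = 0 \<and> b = 0) \<and> (n = 0 \<and> b \<noteq> 0) \<and> d \<noteq> 0, \<not> (d = 0 \<and> b = 0) \<and> b \<noteq> 0 \<and> n \<noteq> 0,
       \<not> (d = 0 \<and> b = 0) \<and> b = 0 \<and> n \<noteq> 0] ! i"
    using le_5_cases[OF i] point_in[OF x] point_in[OF y]
    by (elim disjE)
       (auto simp: scheme_rel_def point_eq_iff eq z coset_eq_0_iff common_line_point_iff line
         T_involution_eq coset_eq_skew_iff coset_in_Gamma_iff one_T coset_eq_fixed_iff fixed skew zero)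
  also have "\<dots> \<longleftrightarrow> cl x y = i"
  proof -
    \<comment> \<open>What remains is propositional: \<open>d = 0\<close> implies
      \<open>n = 0\<close>, and all other combinations are checked by cases.\<close>
    have "[D \<and> B, \<not> (D \<and> B) \<and> N \<and> B, \<not> (D \<and> B) \<and> D, \<not> (D \<and> B) \<and> (N \<and> \<not> B) \<and> \<not> D,
        \<not> (D \<and> B) \<and> \<not> B \<and> \<not> N, \<not> (D \<and> B) \<and> B \<and> \<not> N] ! i \<longleftrightarrow>
      (if D then (if B then 0 else 2) else if N then (if B then 1 else 3) else (if B then 5 else 4)) = i"
      if "D \<Longrightarrow> N" for D B N
      using le_5_cases[OF i] that by (elim disjE; hypsubst_thin; cases D; cases B; cases N) simp_all
    from this[of "d = 0" "n = 0" "b = 0", OF d0] show ?thesis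
      unfolding cl_def cls_def d_def[symmetric] b_def[symmetric] n0 .
  qed
  finally show ?thesis .
qed

section \<open>Transport of the counts to the points of the surface\<close>

abbreviation coord :: "('a ^ 4) set \<Rightarrow> ('a \<times> 'a) \<times> 'a" where
  "coord \<equiv> inv_into heis point"

lemma coord_in: "Q \<in> noncollinear_points q P \<Longrightarrow> coord Q \<in> heis"
  and point_coord: "Q \<in> noncollinear_points q P \<Longrightarrow> point (coord Q) = Q"
  and coord_point: "x \<in> heis \<Longrightarrow> coord (point x) = x"
  using point_bij by (auto simp: inv_into_into f_inv_into_f point_surj bij_betw_def)

lemma card_points: "card (noncollinear_points q P) = q ^ 5"
  using bij_betw_same_card[OF point_bij] card_heis by simp

sublocale scheme: eigenmatrix_scheme "noncollinear_points q P" 5 "scheme_rel q P"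
  "\<lambda>Q R. cl (coord Q) (coord R)" "eigenmatrix_P (real q)" "eigenmatrix_Q (real q)"
proof
  let ?X = "noncollinear_points q P"
  have q: "real q > 0" using q_gt_2 by simp
  show "finite ?X" by (rule finite)
  show "?X \<noteq> {}" using card_points q_gt_2 by auto
  show "scheme_rel q P i = {(Q, R) \<in> ?X \<times> ?X. cl (coord Q) (coord R) = i}" if "i \<le> 5" for i
  proof -
    have "(Q, R) \<in> scheme_rel q P i \<longleftrightarrow> cl (coord Q) (coord R) = i" if "Q \<in> ?X" "R \<in> ?X" for Q R
      using scheme_rel_point[OF coord_in[OF that(1)] coord_in[OF that(2)] \<open>i \<le> 5\<close>] that
      by (simp add: point_coord)
    moreover have "scheme_rel q P i \<subseteq> ?X \<times> ?X" by (auto simp: scheme_rel_def)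
    ultimately show ?thesis by blast
  qed
  show "cl (coord Q) (coord R) \<le> 5" for Q R by (simp add: cl_def cls_le)
  show "cl (coord Q) (coord R) = 0 \<longleftrightarrow> Q = R" if "Q \<in> ?X" "R \<in> ?X" for Q R
    using that point_coord by (metis cl_eq_0_iff)
  show "cl (coord Q) (coord R) = cl (coord R) (coord Q)" for Q R by (rule cl_commute)
  show "\<exists>Q\<in>?X. \<exists>R\<in>?X. cl (coord Q) (coord R) = i" if "i \<le> 5" for i
    using cl_ex[OF that] point_in coord_point by metis
  show "(\<Sum>k\<le>5. eigenmatrix_P (real q) ! i ! k * eigenmatrix_Q (real q) ! k ! j) =
      (if i = j then real (card ?X) else 0)" if "i \<le> 5" "j \<le> 5" for i j
    using eigenmatrix_PQ[OF that q] by (simp add: card_points)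
  show "(\<Sum>k\<le>5. eigenmatrix_Q (real q) ! i ! k * eigenmatrix_P (real q) ! k ! j) =
      (if i = j then real (card ?X) else 0)" if "i \<le> 5" "j \<le> 5" for i j
    using eigenmatrix_QP[OF that q] by (simp add: card_points)
  show "real (card ?X) * real (card {S \<in> ?X. cl (coord Q) (coord S) = i \<and> cl (coord S) (coord R) = j}) =
      (\<Sum>m\<le>5. eigenmatrix_P (real q) ! m ! i * eigenmatrix_P (real q) ! m ! j *
        eigenmatrix_Q (real q) ! cl (coord Q) (coord R) ! m)"
    if "Q \<in> ?X" "R \<in> ?X" "i \<le> 5" "j \<le> 5" for Q R i j
  proof -
    have "bij_betw coord {S \<in> ?X. cl (coord Q) (coord S) = i \<and> cl (coord S) (coord R) = j}
        {z \<in> heis. cl (coord Q) z = i \<and> cl z (coord R) = j}"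
      by (rule bij_betwI[where g = point]) (auto simp: coord_in coord_point point_coord point_in)
    from bij_betw_same_card[OF this] show ?thesis
      using count_heis[OF coord_in[OF that(1)] coord_in[OF that(2)] that(3,4)]
      by (simp add: card_points)
  qed
qed

lemma imprimitive_points: "imprimitive_scheme (noncollinear_points q P) 5 (scheme_rel q P)"
proof (rule scheme.imprimitive[of "{0, 2}" 2 1])
  show "equiv (noncollinear_points q P)
      {(Q, R) \<in> noncollinear_points q P \<times> noncollinear_points q P. cl (coord Q) (coord R) \<in> {0, 2}}"
    unfolding cl_in_0_2_iff by (auto simp: equiv_def refl_on_def sym_def trans_def)
qed auto

end

theorem theorem4p8:
  fixes q :: nat and P :: "('a::{field,finite} ^ 4) set"
  assumes "primepow q" and "odd q" and "CARD('a) = q ^ 2"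
    and "P \<in> hermitian_surface q"
  shows "symmetric_association_scheme (noncollinear_points q P) 5 (scheme_rel q P) \<and>
    imprimitive_scheme (noncollinear_points q P) 5 (scheme_rel q P) \<and>
    (\<exists>E. bij_betw E {..5::nat} (primitive_idempotents (noncollinear_points q P) 5 (scheme_rel q P)) \<and>
         is_first_eigenmatrix 5 (scheme_rel q P) E (eigenmatrix_P (real q)) \<and>
         is_second_eigenmatrix (noncollinear_points q P) 5 (scheme_rel q P) E
           (eigenmatrix_Q (real q)))"
proof -
  interpret hermitian_field q "TYPE('a)" by standard (use assms in auto)
  obtain p where p: "P = vec.span {p}" "p \<noteq> 0" "hform q p p = 0"
    using assms(4) by (auto simp: hermitian_surface_def)
  obtain g k where g: "isometry g" "k \<noteq> 0" "g (mk 1 0 0 0) = k *s p"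
    using isometry_to_point[OF p(2,3)] by blast
  have "vec.span {k *s p} = vec.span {p}"
    using g(2) by (rule span_scale_single)
  then interpret hermitian_frame q P g by unfold_locales (simp_all add: g p(1))
  show ?thesis
    using scheme.symmetric_scheme imprimitive_points scheme.idem_bij
      scheme.first_eigenmatrix scheme.second_eigenmatrix by blast
qed

end
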